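(* Let $q \geq 3$ be a prime power and let $n = q^{2}-1$. Then there exists a quantum code with parameters $[[q^{2}-1,\; q^{2}-4q+5,\; d \geq q]]_{q}$.
   Context: An $[[n,K,d]]_q$ quantum code is a $q^{K}$-dimensional complex subspace $Q$ of $(\mathbb{C}^{q})^{\otimes n}$ with minimum distance $d$; "$d\geq c$" means that the minimum distance is at least $c$, i.e. every error operator $E$ acting nontrivially on at most $c-1$ of the $n$ tensor factors is detectable: $PEP=\lambda_E P$ for some scalar $\lambda_E$, where $P$ is the orthogonal projector onto $Q$. *)

theory Defs
  imports Complex_Main "HOL-Library.FuncSet" "HOL-Library.Function_Algebras"
    "HOL-Number_Theory.Prime_Powers"
begin

text \<open>The tensor power of \<open>\<complex>\<^sup>q\<close> over a finite set \<open>I\<close> of tensor factors is represented in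
  coordinates: the product basis vectors are indexed by the words \<open>I \<rightarrow> {0..<q}\<close>, and a vector
  is its family of coefficients, extended by 0 to arguments that are not words.\<close>

definition words :: "nat \<Rightarrow> nat set \<Rightarrow> (nat \<Rightarrow> nat) set" where
  "words q I = (I \<rightarrow>\<^sub>E {..<q})"

type_synonym state = "(nat \<Rightarrow> nat) \<Rightarrow> complex"

definition tensor_space :: "nat \<Rightarrow> nat set \<Rightarrow> state set" where
  "tensor_space q I = {\<psi>. \<forall>x. x \<notin> words q I \<longrightarrow> \<psi> x = 0}"

definition cscale :: "complex \<Rightarrow> state \<Rightarrow> state" where
  "cscale c \<psi> = (\<lambda>x. c * \<psi> x)"

interpretation state: vector_space cscale
  by unfold_locales (auto simp: cscale_def fun_eq_iff algebra_simps)

definition state_inner :: "nat \<Rightarrow> nat set \<Rightarrow> state \<Rightarrow> state \<Rightarrow> complex" where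
  "state_inner q I \<phi> \<psi> = (\<Sum>x\<in>words q I. cnj (\<phi> x) * \<psi> x)"

definition orth_proj :: "nat \<Rightarrow> nat set \<Rightarrow> state set \<Rightarrow> state \<Rightarrow> state" where
  "orth_proj q I Q \<psi> = (THE \<phi>. \<phi> \<in> Q \<and> (\<forall>\<chi>\<in>Q. state_inner q I \<chi> (\<psi> - \<phi>) = 0))"

text \<open>The operator \<open>A \<otimes> id\<close> on the tensor power over \<open>I\<close>, where \<open>A\<close> is the operator on the
  factors in \<open>S \<subseteq> I\<close> given by its matrix in the product basis. Only the matrix entries at words
  over \<open>S\<close> matter.\<close>

definition tensor_id ::
    "nat \<Rightarrow> nat set \<Rightarrow> nat set \<Rightarrow> ((nat \<Rightarrow> nat) \<Rightarrow> (nat \<Rightarrow> nat) \<Rightarrow> complex) \<Rightarrow> state \<Rightarrow> state" where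
  "tensor_id q I S A \<psi> =
     (\<lambda>x. if x \<in> words q I
          then \<Sum>a\<in>words q S. A (restrict x S) a * \<psi> (override_on x a S) else 0)"

definition detectable :: "nat \<Rightarrow> nat set \<Rightarrow> state set \<Rightarrow> (state \<Rightarrow> state) \<Rightarrow> bool" where
  "detectable q I Q E \<longleftrightarrow>
     (\<exists>c. \<forall>\<psi>\<in>tensor_space q I.
        orth_proj q I Q (E (orth_proj q I Q \<psi>)) = cscale c (orth_proj q I Q \<psi>))"

definition min_distance_ge :: "nat \<Rightarrow> nat \<Rightarrow> state set \<Rightarrow> nat \<Rightarrow> bool" where
  "min_distance_ge q n Q d \<longleftrightarrow>
     (\<forall>S A. S \<subseteq> {..<n} \<and> card S < d \<longrightarrow> detectable q {..<n} Q (tensor_id q {..<n} S A))"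

text \<open>\<open>Q\<close> is an \<open>[[n, K, \<ge> d]]\<^sub>q\<close> code. Note that \<open>K\<close> is the logarithm to base \<open>q\<close> of the
  dimension.\<close>

definition quantum_code :: "nat \<Rightarrow> nat \<Rightarrow> nat \<Rightarrow> nat \<Rightarrow> state set \<Rightarrow> bool" where
  "quantum_code q n K d Q \<longleftrightarrow>
     state.subspace Q \<and> Q \<subseteq> tensor_space q {..<n} \<and> state.dim Q = q ^ K \<and>
     min_distance_ge q n Q d"

end

theory Submission
  imports Defs "HOL-Number_Theory.Cong" "Jordan_Normal_Form.Char_Poly"
begin

hide_const (open) Module.smult

text \<open>
  Let \<open>F\<close> be the field of order \<open>q\<^sup>2\<close> and \<open>n = q\<^sup>2 - 1\<close>. Let \<open>C\<^sub>1\<close> be the code of all words \<open>x\<close> over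
  the subfield of order \<open>q\<close>, with coordinates indexed by the nonzero \<open>a\<close> in \<open>F\<close>, such that
  \<open>\<Sum>\<^sub>a x\<^sub>a a\<^sup>j = 0\<close> for \<open>j \<le> q - 2\<close>, and let \<open>C\<^sub>2\<close> be the code of all words \<open>(Tr f(a))\<^sub>a\<close>, where the
  polynomial \<open>f\<close> over \<open>F\<close> has terms of degree \<open>3, \<dots>, q + 1\<close>. Lagrange interpolation shows that
  \<open>C\<^sub>1\<close> has minimum distance at least \<open>q\<close> and that \<open>C\<^sub>2\<close> restricts onto all words on any \<open>q - 1\<close>
  coordinates. No exponent \<open>k + j\<close> or \<open>q k + j\<close> with \<open>3 \<le> k \<le> q + 1\<close> that occurs is divisible by
  \<open>q\<^sup>2 - 1\<close>, so the power sums vanish and \<open>C\<^sub>2 \<subseteq> C\<^sub>1\<close>. Both redundancies are at most \<open>2q - 3\<close>: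
  for \<open>C\<^sub>1\<close> the sum with \<open>j = 0\<close> lies in the subfield, and for \<open>C\<^sub>2\<close> the element \<open>a\<^bsup>q + 1\<^esup>\<close> does.
  The indicator functions of the cosets of \<open>C\<^sub>2\<close> in \<open>C\<^sub>1\<close> then span the quantum code: an error on
  fewer than \<open>q\<close> factors never connects two different words of \<open>C\<^sub>1\<close>, and its diagonal entries
  have the same sum over every coset. It is harmless, and simplifies the count, to replace \<open>C\<^sub>1\<close> by a
  large fibre of the syndrome map.
\<close>

section \<open>Quantum codes from families of sets of words\<close>

lemma finite_words: "finite I \<Longrightarrow> finite (words q I)"
  by (simp add: words_def finite_PiE)

lemma sum_state_apply: "(\<Sum>i\<in>I. f i) x = (\<Sum>i\<in>I. (f i :: state) x)"
  by (induction I rule: infinite_finite_induct) auto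

text \<open>\<open>distance\<close> removes the off-diagonal entries of an error, and
  \<open>strength\<close> gives its diagonal entries the same sum over every member. Asking for
  injections between all ordered pairs of members yields equal counts without a group structure on
  words.\<close>

locale word_family =
  fixes q n K d :: nat and \<D> :: "(nat \<Rightarrow> nat) set set"
  assumes fin: "finite \<D>" and card_family: "card \<D> = q ^ K"
    and sub: "\<And>D. D \<in> \<D> \<Longrightarrow> D \<subseteq> words q {..<n}"
    and nonempty: "\<And>D. D \<in> \<D> \<Longrightarrow> D \<noteq> {}"
    and member_unique: "\<And>D D' x. \<lbrakk>D \<in> \<D>; D' \<in> \<D>; x \<in> D; x \<in> D'\<rbrakk> \<Longrightarrow> D = D'"
    and d_pos: "d > 0"
    and distance: "\<And>x y S. \<lbrakk>x \<in> \<Union>\<D>; y \<in> \<Union>\<D>; S \<subseteq> {..<n}; card S < d;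
        \<And>i. i \<in> {..<n} - S \<Longrightarrow> x i = y i\<rbrakk> \<Longrightarrow> x = y"
    and strength: "\<And>D D' S. \<lbrakk>D \<in> \<D>; D' \<in> \<D>; S \<subseteq> {..<n}; card S < d\<rbrakk> \<Longrightarrow>
        \<exists>h. inj_on h D \<and> h ` D \<subseteq> D' \<and> (\<forall>x\<in>D. \<forall>i\<in>S. h x i = x i)"
begin

definition ind :: "(nat \<Rightarrow> nat) set \<Rightarrow> state" where
  "ind D = (\<lambda>x. of_bool (x \<in> D))"

definition Q :: "state set" where
  "Q = state.span (ind ` \<D>)"

lemma finite_member: "D \<in> \<D> \<Longrightarrow> finite D"
  using finite_subset[OF sub finite_words] by blast

definition comb :: "((nat \<Rightarrow> nat) set \<Rightarrow> complex) \<Rightarrow> state" where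
  "comb c = (\<Sum>D\<in>\<D>. cscale (c D) (ind D))"

lemma comb_apply: "D \<in> \<D> \<Longrightarrow> x \<in> D \<Longrightarrow> comb c x = c D"
proof -
  assume D: "D \<in> \<D>" "x \<in> D"
  have "comb c x = (\<Sum>D'\<in>\<D>. if D' = D then c D else 0)"
    unfolding comb_def sum_state_apply cscale_def ind_def
    using D member_unique by (intro sum.cong) auto
  then show ?thesis using D fin by simp
qed

lemma comb_apply_0: "x \<notin> \<Union>\<D> \<Longrightarrow> comb c x = 0"
  unfolding comb_def sum_state_apply cscale_def ind_def by (intro sum.neutral) auto

lemma inj_ind: "inj_on ind \<D>"
  by (rule inj_onI) (auto simp: ind_def fun_eq_iff of_bool_eq_iff)

lemma Q_eq: "Q = range comb"
proof -
  have "comb c \<in> Q" for c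
    unfolding Q_def comb_def
    by (intro state.span_sum state.span_scale state.span_base) auto
  moreover have "\<exists>c. x = comb c" if "x \<in> Q" for x
  proof -
    from that obtain u where "x = (\<Sum>v\<in>ind ` \<D>. cscale (u v) v)"
      unfolding Q_def using state.span_finite[of "ind ` \<D>"] fin by auto
    then have "x = comb (u \<circ> ind)"
      unfolding comb_def by (simp add: sum.reindex[OF inj_ind])
    then show ?thesis by blast
  qed
  ultimately show ?thesis by blast
qed

lemma dim_Q: "state.dim Q = q ^ K"
proof -
  have "state.independent (ind ` \<D>)"
  proof (rule state.independent_if_scalars_zero)
    show "finite (ind ` \<D>)" using fin by simp
    fix f x assume *: "(\<Sum>x\<in>ind ` \<D>. cscale (f x) x) = 0" and "x \<in> ind ` \<D>"
    then obtain D where D: "D \<in> \<D>" "x = ind D" by blast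
    obtain w where w: "w \<in> D" using nonempty D by blast
    have "comb (f \<circ> ind) = 0"
      unfolding comb_def using * by (simp add: sum.reindex[OF inj_ind])
    then show "f x = 0" using comb_apply[OF D(1) w, of "f \<circ> ind"] D by simp
  qed
  then show ?thesis
    unfolding Q_def by (simp add: state.dim_eq_card_independent state.dim_span card_image[OF inj_ind] card_family)
qed

definition block_size :: nat where "block_size = card (SOME D. D \<in> \<D>)"

lemma card_restrict_le:
  assumes "D \<in> \<D>" "D' \<in> \<D>" "S \<subseteq> {..<n}" "card S < d"
  shows "card {x\<in>D. restrict x S = a} \<le> card {x\<in>D'. restrict x S = a}"
proof -
  obtain h where h: "inj_on h D" "h ` D \<subseteq> D'" "\<forall>x\<in>D. \<forall>i\<in>S. h x i = x i"
    using strength[OF assms] by blast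
  have "restrict (h x) S = restrict x S" if "x \<in> D" for x
    using h(3) that by (auto simp: restrict_def fun_eq_iff)
  then have "h ` {x\<in>D. restrict x S = a} \<subseteq> {x\<in>D'. restrict x S = a}"
    using h(2) by auto
  moreover have "inj_on h {x\<in>D. restrict x S = a}"
    using h(1) by (rule inj_on_subset) auto
  ultimately show ?thesis
    using finite_member[OF assms(2)] by (intro card_inj_on_le) auto
qed

text \<open>Words are grouped by their restriction to \<open>S\<close>. The injections in both
  directions show that each restriction occurs equally often in \<open>D\<close> and
  \<open>D'\<close>.\<close>

lemma sum_restrict_eq:
  fixes f :: "(nat \<Rightarrow> nat) \<Rightarrow> complex"
  assumes "D \<in> \<D>" "D' \<in> \<D>" "S \<subseteq> {..<n}" "card S < d"
  shows "(\<Sum>x\<in>D. f (restrict x S)) = (\<Sum>x\<in>D'. f (restrict x S))"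
proof -
  define R where "R = (\<lambda>x. restrict x S) ` (D \<union> D')"
  have fin': "finite D" "finite D'" "finite R"
    using finite_member assms by (auto simp: R_def)
  have *: "(\<Sum>x\<in>C. f (restrict x S)) = (\<Sum>a\<in>R. of_nat (card {x\<in>C. restrict x S = a}) * f a)"
    if "C \<subseteq> D \<union> D'" for C
  proof -
    have "(\<Sum>x\<in>C. f (restrict x S)) = (\<Sum>a\<in>R. \<Sum>x\<in>{x\<in>C. restrict x S = a}. f (restrict x S))"
      using fin' that finite_subset[OF that]
      by (intro sum.group[symmetric]) (auto simp: R_def)
    also have "\<dots> = (\<Sum>a\<in>R. of_nat (card {x\<in>C. restrict x S = a}) * f a)"
      by (intro sum.cong) auto
    finally show ?thesis .
  qed
  have "card {x\<in>D. restrict x S = a} = card {x\<in>D'. restrict x S = a}" for a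
    using card_restrict_le assms by (intro antisym) auto
  then show ?thesis using *[of D] *[of D'] by simp
qed

lemma card_member:
  assumes "D \<in> \<D>"
  shows "card D = block_size"
proof -
  have "(SOME D. D \<in> \<D>) \<in> \<D>" using assms by (rule someI)
  \<comment> \<open>For the empty \<open>S\<close> all words have the same restriction, so equal
    frequencies mean equal sizes; \<open>d_pos\<close> admits this \<open>S\<close>.\<close>
  then have "(\<Sum>x\<in>D. 1) = (\<Sum>x\<in>(SOME D. D \<in> \<D>). (1 :: complex))"
    using sum_restrict_eq[of D _ "{}" "\<lambda>_. 1"] assms d_pos by simp
  then show ?thesis unfolding block_size_def by simp
qed

text \<open>The members are disjoint and of equal size, so projecting onto the span of their
  indicators replaces a state by its mean on each member and by 0 elsewhere.\<close>

definition proj :: "state \<Rightarrow> state" where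
  "proj \<psi> = comb (\<lambda>D. (\<Sum>x\<in>D. \<psi> x) / of_nat block_size)"

lemma inner_comb: "state_inner q {..<n} (comb c) \<psi> = (\<Sum>D\<in>\<D>. cnj (c D) * (\<Sum>x\<in>D. \<psi> x))"
proof -
  have "state_inner q {..<n} (comb c) \<psi> = (\<Sum>x\<in>\<Union>\<D>. cnj (comb c x) * \<psi> x)"
    unfolding state_inner_def
    by (intro sum.mono_neutral_right finite_words) (use sub comb_apply_0 in auto)
  also have "\<dots> = (\<Sum>D\<in>\<D>. \<Sum>x\<in>D. cnj (comb c x) * \<psi> x)"
    using finite_member member_unique by (subst sum.Union_disjoint) auto
  also have "\<dots> = (\<Sum>D\<in>\<D>. cnj (c D) * (\<Sum>x\<in>D. \<psi> x))"
    by (intro sum.cong) (auto simp: comb_apply sum_distrib_left)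
  finally show ?thesis .
qed

lemma block_size_pos: "D \<in> \<D> \<Longrightarrow> block_size > 0"
  using card_member nonempty finite_member by fastforce

lemma orth_proj_eq: "orth_proj q {..<n} Q \<psi> = proj \<psi>"
  unfolding orth_proj_def
proof (rule the_equality)
  have mean: "(\<Sum>x\<in>D. proj \<psi> x) = (\<Sum>x\<in>D. \<psi> x)" if "D \<in> \<D>" for D
  proof -
    have "(\<Sum>x\<in>D. proj \<psi> x) = (\<Sum>x\<in>D. (\<Sum>x\<in>D. \<psi> x) / of_nat block_size)"
      unfolding proj_def using that by (intro sum.cong) (auto simp: comb_apply)
    then show ?thesis using card_member[OF that] block_size_pos[OF that] by simp
  qed
  show "proj \<psi> \<in> Q \<and> (\<forall>\<chi>\<in>Q. state_inner q {..<n} \<chi> (\<psi> - proj \<psi>) = 0)"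
    unfolding Q_eq using mean by (auto simp: proj_def[of \<psi>] inner_comb sum_subtractf)
next
  fix \<phi> assume *: "\<phi> \<in> Q \<and> (\<forall>\<chi>\<in>Q. state_inner q {..<n} \<chi> (\<psi> - \<phi>) = 0)"
  then obtain c where c: "\<phi> = comb c" unfolding Q_eq by blast
  have "c D = (\<Sum>x\<in>D. \<psi> x) / of_nat block_size" if D: "D \<in> \<D>" for D
  proof -
    \<comment> \<open>Testing against the indicator of \<open>D\<close> alone isolates the
      coefficient \<open>c D\<close>.\<close>
    have "state_inner q {..<n} (comb (\<lambda>D'. of_bool (D' = D))) (\<psi> - \<phi>) = 0"
      using * unfolding Q_eq by blast
    then have "0 = (\<Sum>D'\<in>\<D>. if D' = D then (\<Sum>x\<in>D. \<psi> x - \<phi> x) else 0)"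
      unfolding inner_comb by (subst (asm) sum.cong[OF refl, of _ _ "\<lambda>D'. if D' = D then (\<Sum>x\<in>D. \<psi> x - \<phi> x) else 0"]) auto
    then have "(\<Sum>x\<in>D. \<psi> x) = (\<Sum>x\<in>D. \<phi> x)" using D fin by (simp add: sum_subtractf)
    also have "\<dots> = (\<Sum>x\<in>D. c D)" unfolding c using D by (intro sum.cong) (auto simp: comb_apply)
    finally show ?thesis using card_member[OF D] block_size_pos[OF D] by (simp add: field_simps)
  qed
  then show "\<phi> = proj \<psi>"
    unfolding c proj_def comb_def by (intro sum.cong) auto
qed

text \<open>An off-diagonal term reads the state at a word that differs from \<open>y\<close> only
  within \<open>S\<close>. By \<open>distance\<close> this word lies outside all members, where
  \<open>comb c\<close> vanishes.\<close>

lemma tensor_id_comb: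
  assumes "D \<in> \<D>" "y \<in> D" and S: "S \<subseteq> {..<n}" "card S < d"
  shows "tensor_id q {..<n} S A (comb c) y = A (restrict y S) (restrict y S) * c D"
proof -
  have y: "y \<in> words q {..<n}" using sub assms by blast
  have r: "restrict y S \<in> words q S" using y S by (auto simp: words_def)
  have "comb c (override_on y a S) = 0"
    if "a \<in> words q S" "a \<noteq> restrict y S" for a
  proof (rule comb_apply_0, rule notI)
    assume "override_on y a S \<in> \<Union>\<D>"
    then have eq: "override_on y a S = y"
      using assms by (intro distance[of _ y S]) (auto simp: override_on_def)
    have "a i = y i" if "i \<in> S" for i
      using fun_cong[OF eq, of i] that by (simp add: override_on_def)
    then have "a = restrict y S"
      using \<open>a \<in> words q S\<close> by (auto simp: words_def fun_eq_iff PiE_def extensional_def)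
    with that show False by simp
  qed
  then have "(\<Sum>a\<in>words q S. A (restrict y S) a * comb c (override_on y a S))
    = (\<Sum>a\<in>{restrict y S}. A (restrict y S) a * comb c (override_on y a S))"
    using r S by (intro sum.mono_neutral_right finite_words) (auto intro: finite_subset)
  moreover have "override_on y (restrict y S) S = y" by (auto simp: override_on_def)
  ultimately show ?thesis using y assms by (simp add: tensor_id_def comb_apply)
qed

text \<open>The mean of the diagonal entries over a member is the same for every member; this common
  mean is the detection scalar.\<close>

lemma detectable_Q:
  assumes S: "S \<subseteq> {..<n}" "card S < d"
  shows "detectable q {..<n} Q (tensor_id q {..<n} S A)"
proof -
  define t where "t = (\<Sum>x\<in>(SOME D. D \<in> \<D>). A (restrict x S) (restrict x S))"
  have t: "(\<Sum>x\<in>D. A (restrict x S) (restrict x S)) = t" if "D \<in> \<D>" for D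
    unfolding t_def using that S by (intro sum_restrict_eq someI[of "\<lambda>D. D \<in> \<D>"])
  have "proj (tensor_id q {..<n} S A (comb c)) = cscale (t / of_nat block_size) (comb c)" for c
  proof
    fix x
    show "proj (tensor_id q {..<n} S A (comb c)) x = cscale (t / of_nat block_size) (comb c) x"
    proof (cases "x \<in> \<Union>\<D>")
      case True
      then obtain D where D: "D \<in> \<D>" "x \<in> D" by blast
      have "(\<Sum>y\<in>D. tensor_id q {..<n} S A (comb c) y) = t * c D"
        unfolding t[OF D(1), symmetric] using D S
        by (simp add: tensor_id_comb sum_distrib_right)
      then show ?thesis using D by (simp add: proj_def comb_apply cscale_def)
    qed (simp add: proj_def comb_apply_0 cscale_def)
  qed
  then show ?thesis
    unfolding detectable_def orth_proj_eq by (metis proj_def)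
qed

lemma quantum_code_Q: "quantum_code q n K d Q"
  unfolding quantum_code_def
proof (intro conjI dim_Q)
  show "state.subspace Q" unfolding Q_def by (rule state.subspace_span)
  show "Q \<subseteq> tensor_space q {..<n}"
    unfolding Q_eq tensor_space_def using sub comb_apply_0 by blast
  show "min_distance_ge q n Q d" unfolding min_distance_ge_def using detectable_Q by blast
qed

end

section \<open>Codes over a residue field of order \<open>q\<^sup>2\<close>\<close>

lemma pigeonhole_fibre:
  assumes "finite A" "finite B" "A \<noteq> {}" "f ` A \<subseteq> B"
  shows "\<exists>b\<in>B. card A \<le> card B * card {a\<in>A. f a = b}"
proof -
  define \<mu> where "\<mu> = Max ((\<lambda>b. card {a\<in>A. f a = b}) ` B)"
  have "B \<noteq> {}" using assms by auto
  then have "\<mu> \<in> (\<lambda>b. card {a\<in>A. f a = b}) ` B"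
    unfolding \<mu>_def using assms by (intro Max_in) auto
  then obtain b where b: "b \<in> B" "\<mu> = card {a\<in>A. f a = b}" by blast
  have "card A = (\<Sum>b\<in>B. card {a\<in>A. f a = b})"
    using sum.group[OF assms(1,2,4), of "\<lambda>_. 1 :: nat"] by simp
  also have "\<dots> \<le> card B * \<mu>"
    using sum_bounded_above[of B "\<lambda>b. card {a\<in>A. f a = b}" \<mu>] assms by (simp add: \<mu>_def)
  finally show ?thesis using b by blast
qed

section \<open>Congruence modulo an ideal\<close>

locale comm_ring_ideal =
  fixes M :: "'a :: comm_ring_1 set"
  assumes zero_M: "0 \<in> M"
    and add_M: "\<And>x y. x \<in> M \<Longrightarrow> y \<in> M \<Longrightarrow> x + y \<in> M"
    and mult_M: "\<And>x r. x \<in> M \<Longrightarrow> r * x \<in> M"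
begin

definition eqM :: "'a \<Rightarrow> 'a \<Rightarrow> bool" (infix "\<approx>" 50) where
  "x \<approx> y \<longleftrightarrow> x - y \<in> M"

lemma minus_M: "x \<in> M \<Longrightarrow> - x \<in> M"
  using mult_M[of x "- 1"] by simp

lemma eqM_refl [simp, intro]: "x \<approx> x"
  by (simp add: eqM_def zero_M)

lemma eqM_sym: "x \<approx> y \<Longrightarrow> y \<approx> x"
  unfolding eqM_def using minus_M[of "x - y"] by simp

lemma eqM_trans [trans]: "x \<approx> y \<Longrightarrow> y \<approx> w \<Longrightarrow> x \<approx> w"
  unfolding eqM_def using add_M[of "x - y" "y - w"] by simp

text \<open>Instances of the substitution rules, which spare \<open>also\<close> a higher-order unification
  against large terms.\<close>

lemma eq_eqM_trans [trans]: "x = y \<Longrightarrow> y \<approx> w \<Longrightarrow> x \<approx> w"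
  and eqM_eq_trans [trans]: "x \<approx> y \<Longrightarrow> y = w \<Longrightarrow> x \<approx> w"
  by simp_all

lemma eqM_add: "x \<approx> x' \<Longrightarrow> y \<approx> y' \<Longrightarrow> x + y \<approx> x' + y'"
  unfolding eqM_def using add_M[of "x - x'" "y - y'"] by (simp add: algebra_simps)

lemma eqM_minus: "x \<approx> x' \<Longrightarrow> - x \<approx> - x'"
  unfolding eqM_def using minus_M[of "x - x'"] by (simp add: algebra_simps)

lemma eqM_diff: "x \<approx> x' \<Longrightarrow> y \<approx> y' \<Longrightarrow> x - y \<approx> x' - y'"
  using eqM_add[OF _ eqM_minus] by simp

lemma eqM_mult: "x \<approx> x' \<Longrightarrow> y \<approx> y' \<Longrightarrow> x * y \<approx> x' * y'"
  unfolding eqM_def using add_M[OF mult_M[of "x - x'" y] mult_M[of "y - y'" x']]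
  by (simp add: algebra_simps)

lemma eqM_power: "x \<approx> y \<Longrightarrow> x ^ k \<approx> y ^ k"
  by (induction k) (auto intro: eqM_mult)

lemma eqM_sum: "(\<And>i. i \<in> I \<Longrightarrow> f i \<approx> g i) \<Longrightarrow> sum f I \<approx> sum g I"
  by (induction I rule: infinite_finite_induct) (auto intro: eqM_add)

lemma eqM_0_iff: "x \<approx> 0 \<longleftrightarrow> x \<in> M"
  by (simp add: eqM_def)

end

text \<open>The order of the field depends on \<open>q\<close>, so the field cannot be a type. It is represented by a
  ring modulo an ideal \<open>M\<close>, such that \<open>z\<close> generates the multiplicative group of the quotient.\<close>

locale residue_field = comm_ring_ideal M
  for M :: "'a :: comm_ring_1 set" +
  fixes z :: 'a and q N :: nat
  assumes q_ge: "q \<ge> 3" and N_def: "N = q\<^sup>2 - 1"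
    and one_notin_M: "1 \<notin> M"
    and residue: "\<And>x. x \<in> M \<or> (\<exists>i. x \<approx> z ^ i)"
    and power_eqM_1_iff: "\<And>i. z ^ i \<approx> 1 \<longleftrightarrow> N dvd i"
    and frobenius_add: "\<And>x y. (x + y) ^ q \<approx> x ^ q + y ^ q"
begin

section \<open>Powers of the generator and the Frobenius map\<close>

lemma N_eq: "N = (q - 1) * (q + 1)"
  by (simp add: N_def power2_eq_square algebra_simps)

lemma N_bound: "N > 2 * q - 1" "N > q + 1" "N > 0"
proof -
  have "3 * q \<le> q * q" using q_ge by (intro mult_right_mono) auto
  then show "N > 2 * q - 1" "N > q + 1" "N > 0" unfolding N_def power2_eq_square using q_ge by linarith+
qed

text \<open>\<open>z ^ i\<close> is a unit modulo \<open>M\<close>, with inverse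
  \<open>z ^ (i * (N - 1))\<close>, and a proper ideal contains no such element.\<close>

lemma power_notin_M: "z ^ i \<notin> M"
proof
  assume "z ^ i \<in> M"
  then have "z ^ i * z ^ (i * (N - 1)) \<in> M" using mult_M by (metis mult.commute)
  moreover have "i + i * (N - 1) = i * N" using N_bound by (cases N) auto
  ultimately have "z ^ (i * N) \<approx> 0" by (simp add: eqM_0_iff flip: power_add)
  moreover have "z ^ (i * N) \<approx> 1" by (simp add: power_eqM_1_iff)
  ultimately have "1 \<approx> 0" using eqM_sym eqM_trans by blast
  then show False using one_notin_M by (simp add: eqM_0_iff)
qed

lemma inverse_ex:
  assumes "x \<notin> M"
  shows "\<exists>r. r * x \<approx> 1"
proof -
  obtain i where "x \<approx> z ^ i" using residue assms by blast
  then have "z ^ (i * (N - 1)) * x \<approx> z ^ (i * (N - 1)) * z ^ i" by (intro eqM_mult) auto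
  also have "\<dots> = z ^ (i * N)" using N_bound by (cases N) (auto simp flip: power_add simp: add.commute)
  also have "\<dots> \<approx> 1" by (simp add: power_eqM_1_iff)
  finally show ?thesis by blast
qed

lemma prime_M: "x * y \<in> M \<Longrightarrow> x \<in> M \<or> y \<in> M"
proof (rule ccontr)
  assume "x * y \<in> M" "\<not> (x \<in> M \<or> y \<in> M)"
  then obtain r where "r * x \<approx> 1" using inverse_ex by blast
  then have "(r * x) * y \<approx> 1 * y" by (intro eqM_mult) auto
  moreover have "(r * x) * y \<in> M" using mult_M[OF \<open>x * y \<in> M\<close>, of r] by (simp add: mult_ac)
  ultimately have "y \<approx> 0" using eqM_sym eqM_trans by (metis eqM_0_iff mult_1)
  then show False using \<open>\<not> (x \<in> M \<or> y \<in> M)\<close> by (simp add: eqM_0_iff)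
qed

lemma power_eqM_imp_dvd:
  assumes "z ^ i \<approx> z ^ j" "i \<le> j"
  shows "N dvd j - i"
proof -
  have "z ^ i * (z ^ (j - i) - 1) = z ^ j - z ^ i"
    using assms by (simp add: algebra_simps flip: power_add)
  moreover have "z ^ j - z ^ i \<in> M" using eqM_sym[OF assms(1)] by (simp add: eqM_def)
  ultimately have "z ^ (j - i) - 1 \<in> M" using prime_M[of "z ^ i"] power_notin_M by auto
  then show ?thesis using power_eqM_1_iff by (simp add: eqM_def)
qed

lemma power_eqM_inj: "z ^ i \<approx> z ^ j \<Longrightarrow> i < N \<Longrightarrow> j < N \<Longrightarrow> i = j"
proof (induction i j rule: linorder_wlog)
  case (le i j)
  then show ?case using power_eqM_imp_dvd[of i j] by (auto dest!: dvd_imp_le)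
next
  case (sym i j)
  then show ?case using eqM_sym by auto
qed

lemma power_mod_N: "z ^ i \<approx> z ^ (i mod N)"
proof -
  have "z ^ i = z ^ (N * (i div N)) * z ^ (i mod N)" by (simp flip: power_add)
  also have "\<dots> \<approx> 1 * z ^ (i mod N)"
    by (intro eqM_mult) (simp_all add: power_eqM_1_iff)
  finally show ?thesis by simp
qed

lemma zero_power_q: "(0 :: 'a) ^ q = 0"
  using q_ge by (cases q) auto

lemma power_q_q: "(x ^ q) ^ q \<approx> x"
proof (cases "x \<in> M")
  case True
  then have "x \<approx> 0" by (simp add: eqM_0_iff)
  then have "(x ^ q) ^ q \<approx> (0 ^ q) ^ q" by (intro eqM_power)
  also have "\<dots> = 0" by (simp add: zero_power_q)
  also have "0 \<approx> x" using \<open>x \<approx> 0\<close> by (rule eqM_sym)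
  finally show ?thesis .
next
  case False
  then obtain i where i: "x \<approx> z ^ i" using residue by blast
  then have "(x ^ q) ^ q \<approx> ((z ^ i) ^ q) ^ q" by (intro eqM_power)
  also have "\<dots> = z ^ (i * q * q)" by (simp only: power_mult)
  also have "\<dots> = z ^ (N * i + i)"
  proof -
    have "Suc N = q * q" using N_bound(3) by (simp add: N_def power2_eq_square)
    then have "Suc N * i = i * q * q" by simp
    then show ?thesis by (simp add: add.commute)
  qed
  also have "\<dots> = z ^ (N * i) * z ^ i" by (simp add: power_add)
  also have "\<dots> \<approx> 1 * z ^ i" by (intro eqM_mult) (simp_all add: power_eqM_1_iff)
  also have "1 * z ^ i \<approx> x" using eqM_sym[OF i] by simp
  finally show ?thesis .
qed

lemma frobenius_sum: "sum f I ^ q \<approx> (\<Sum>i\<in>I. f i ^ q)"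
proof (induction I rule: infinite_finite_induct)
  case (insert i I)
  have "sum f (insert i I) ^ q \<approx> f i ^ q + sum f I ^ q"
    using insert.hyps by (simp add: frobenius_add)
  also have "\<dots> \<approx> f i ^ q + (\<Sum>i\<in>I. f i ^ q)" using insert.IH by (intro eqM_add) auto
  finally show ?case using insert.hyps by simp
qed (simp_all add: zero_power_q)

text \<open>Additivity applied to \<open>x + - x\<close> avoids a case split on the parity of
  \<open>q\<close>.\<close>

lemma frobenius_minus: "(- x) ^ q \<approx> - (x ^ q)"
proof -
  have "0 = (x + - x) ^ q" by (simp add: zero_power_q)
  also have "\<dots> \<approx> x ^ q + (- x) ^ q" by (rule frobenius_add)
  finally have "0 - x ^ q \<approx> (x ^ q + (- x) ^ q) - x ^ q" by (intro eqM_diff) auto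
  from eqM_sym[OF this] show ?thesis by simp
qed

section \<open>The subfield of order \<open>q\<close>, trace and norm\<close>

definition subfield :: "'a set" where
  "subfield = {x. x ^ q \<approx> x}"

lemma subfield_add: "x \<in> subfield \<Longrightarrow> y \<in> subfield \<Longrightarrow> x + y \<in> subfield"
  by (simp add: subfield_def eqM_trans[OF frobenius_add eqM_add])

lemma subfield_minus: "x \<in> subfield \<Longrightarrow> - x \<in> subfield"
  by (simp add: subfield_def eqM_trans[OF frobenius_minus eqM_minus])

lemma subfield_diff: "x \<in> subfield \<Longrightarrow> y \<in> subfield \<Longrightarrow> x - y \<in> subfield"
  using subfield_add[OF _ subfield_minus] by simp

lemma subfield_mult: "x \<in> subfield \<Longrightarrow> y \<in> subfield \<Longrightarrow> x * y \<in> subfield"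
  unfolding subfield_def by (simp add: power_mult_distrib eqM_mult)

lemma subfield_0: "0 \<in> subfield"
  by (simp add: subfield_def zero_power_q)

lemma subfield_sum: "(\<And>i. i \<in> I \<Longrightarrow> f i \<in> subfield) \<Longrightarrow> sum f I \<in> subfield"
  by (induction I rule: infinite_finite_induct) (auto intro: subfield_add subfield_0)

lemma subfield_cong:
  assumes "x \<in> subfield" "x \<approx> y"
  shows "y \<in> subfield"
proof -
  have "y ^ q \<approx> x ^ q" by (intro eqM_power eqM_sym[OF assms(2)])
  also have "\<dots> \<approx> x" using assms(1) by (simp add: subfield_def)
  also have "\<dots> \<approx> y" by (rule assms(2))
  finally show ?thesis by (simp add: subfield_def)
qed

lemma trace_in_subfield: "x + x ^ q \<in> subfield"
proof -
  have "(x + x ^ q) ^ q \<approx> x ^ q + (x ^ q) ^ q" by (rule frobenius_add)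
  also have "\<dots> \<approx> x ^ q + x" by (intro eqM_add power_q_q) auto
  finally show ?thesis by (simp add: subfield_def add.commute)
qed

text \<open>The element is the norm of \<open>z ^ i\<close>; raising it to the power
  \<open>q\<close> adds the multiple \<open>N * i\<close> to the exponent.\<close>

lemma norm_in_subfield: "z ^ (i * (q + 1)) \<in> subfield"
proof -
  have "i * (q + 1) * q = N * i + i * (q + 1)"
    unfolding N_eq using q_ge by (cases q) (auto simp: algebra_simps)
  then have "(z ^ (i * (q + 1))) ^ q = z ^ (N * i) * z ^ (i * (q + 1))"
    by (simp only: flip: power_mult power_add)
  also have "\<dots> \<approx> 1 * z ^ (i * (q + 1))" by (intro eqM_mult) (simp_all add: power_eqM_1_iff)
  finally show ?thesis by (simp add: subfield_def)
qed

text \<open>The trace is linear over the subfield and not identically zero, so an element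
  \<open>t\<close> of nonzero trace can be scaled by \<open>b\<close> divided by that trace.\<close>

lemma trace_surj:
  assumes "b \<in> subfield"
  shows "\<exists>e. e + e ^ q \<approx> b"
proof -
  \<comment> \<open>If all traces vanished, the trace of 1 would give 2 = 0 and that of
    \<open>z\<close> then \<open>z ^ q = z\<close> modulo \<open>M\<close>, so \<open>N\<close>
    would divide \<open>q - 1\<close>.\<close>
  have "\<exists>t. t + t ^ q \<notin> M"
  proof (rule ccontr)
    assume *: "\<not> (\<exists>t. t + t ^ q \<notin> M)"
    then have "1 + 1 ^ q \<in> M" by blast
    then have "z * (1 + 1 ^ q) \<in> M" by (rule mult_M)
    moreover have "z + z ^ q \<in> M" using * by blast
    ultimately have "(z + z ^ q) - z * (1 + 1 ^ q) \<in> M"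
      using add_M[OF _ minus_M] by fastforce
    then have "z ^ q \<approx> z ^ 1" by (simp add: eqM_def algebra_simps)
    then have "N dvd q - 1" using power_eqM_imp_dvd[OF eqM_sym] q_ge by auto
    then have "N \<le> q - 1" using q_ge by (intro dvd_imp_le) auto
    then show False using N_bound by simp
  qed
  then obtain t r where t: "t + t ^ q \<notin> M" "r * (t + t ^ q) \<approx> 1" using inverse_ex by blast
  have tr: "(t + t ^ q) ^ q \<approx> t + t ^ q" using trace_in_subfield by (simp add: subfield_def)
  \<comment> \<open>The inverse of a subfield element lies in the subfield, which lets
    \<open>r\<close> be moved out of the trace.\<close>
  have "r ^ q = r ^ q * 1" by simp
  also have "\<dots> \<approx> r ^ q * (r * (t + t ^ q))" by (intro eqM_mult eqM_sym[OF t(2)]) auto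
  also have "\<dots> = r * (r ^ q * (t + t ^ q))" by (simp add: mult_ac)
  also have "\<dots> \<approx> r * (r ^ q * (t + t ^ q) ^ q)" by (intro eqM_mult eqM_sym[OF tr]) auto
  also have "\<dots> = r * (r * (t + t ^ q)) ^ q" by (simp add: power_mult_distrib)
  also have "\<dots> \<approx> r * 1 ^ q" by (intro eqM_mult eqM_power t) auto
  finally have "r \<in> subfield" by (simp add: subfield_def)
  then have "(b * r) ^ q \<approx> b * r" using subfield_mult[OF assms] by (auto simp: subfield_def)
  then have "b * r * t + (b * r) ^ q * t ^ q \<approx> b * r * t + (b * r) * t ^ q"
    by (intro eqM_add eqM_mult) auto
  also have "\<dots> = b * (r * (t + t ^ q))" by (simp add: algebra_simps)
  also have "\<dots> \<approx> b * 1" by (intro eqM_mult t) auto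
  finally have "b * r * t + (b * r * t) ^ q \<approx> b" by (simp add: power_mult_distrib)
  then show ?thesis by blast
qed

text \<open>The alphabet \<open>{..<q}\<close> of the quantum code is identified with the subfield of order \<open>q\<close>,
  whose nonzero elements are the powers of \<open>z ^ (q + 1)\<close>.\<close>

definition enc :: "nat \<Rightarrow> 'a" where
  "enc s = (if s = 0 then 0 else z ^ ((s - 1) * (q + 1)))"

lemma enc_in_subfield: "enc s \<in> subfield"
  unfolding enc_def
  by (cases "s = 0") (simp_all only: simp_thms if_True if_False norm_in_subfield subfield_0)

lemma enc_inj:
  assumes "enc s \<approx> enc t" "s < q" "t < q"
  shows "s = t"
proof (cases "s = 0 \<or> t = 0")
  case True
  then show ?thesis
    using assms power_notin_M eqM_sym[OF assms(1)] by (auto simp: enc_def eqM_0_iff split: if_splits)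
next
  case False
  have bound: "(k - 1) * (q + 1) < N" if "k < q" "k \<noteq> 0" for k
    unfolding N_eq using that by (intro mult_strict_right_mono) auto
  have "(s - 1) * (q + 1) = (t - 1) * (q + 1)"
    using assms False bound by (intro power_eqM_inj) (auto simp: enc_def)
  then have "s - 1 = t - 1" by (subst (asm) mult_cancel2) simp
  then show ?thesis using False by auto
qed

lemma enc_surj:
  assumes "x \<in> subfield"
  shows "\<exists>s<q. enc s \<approx> x"
proof (cases "x \<in> M")
  case True
  then have "enc 0 \<approx> x" by (simp add: enc_def eqM_sym eqM_0_iff)
  then show ?thesis using q_ge by (intro exI[of _ 0]) auto
next
  case False
  then obtain i' where "x \<approx> z ^ i'" using residue by blast
  \<comment> \<open>Reducing the exponent below \<open>N\<close> is what later keeps the symbol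
    \<open>Suc k\<close> below \<open>q\<close>.\<close>
  moreover define i where "i = i' mod N"
  ultimately have i: "x \<approx> z ^ i" "i < N" using eqM_trans power_mod_N N_bound by auto
  have "z ^ (i * q) \<approx> z ^ i"
    using subfield_cong[OF assms i(1)] by (simp add: subfield_def power_mult)
  \<comment> \<open>Since \<open>N = (q - 1) * (q + 1)\<close>, a power of \<open>z\<close> fixed by
    Frobenius has an exponent divisible by \<open>q + 1\<close>.\<close>
  then have "N dvd i * q - i" using power_eqM_imp_dvd[OF eqM_sym] q_ge by simp
  also have "i * q - i = (q - 1) * i" by (simp add: algebra_simps diff_mult_distrib2)
  finally have "q + 1 dvd i" unfolding N_eq using q_ge by (subst (asm) nat_mult_dvd_cancel1) auto
  then obtain k where k: "i = (q + 1) * k" by blast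
  have "k < q - 1" using i(2) unfolding k N_eq by (simp only: mult.commute[of "q + 1"] mult_less_cancel2)
  then have "Suc k < q" "enc (Suc k) \<approx> x" using eqM_sym[OF i(1)] by (auto simp: enc_def k mult.commute)
  then show ?thesis by blast
qed

text \<open>One representative is picked per residue class, so that classes can be counted as values
  of \<open>nf\<close>.\<close>

definition nf :: "'a \<Rightarrow> 'a" where
  "nf x = (SOME y. y \<approx> x)"

lemma nf_eqM: "nf x \<approx> x"
  unfolding nf_def by (rule someI[of _ x]) simp

lemma nf_eq_iff: "nf x = nf y \<longleftrightarrow> x \<approx> y"
proof
  assume "nf x = nf y"
  then show "x \<approx> y" using nf_eqM[of x] nf_eqM[of y] eqM_sym eqM_trans by metis
next
  assume "x \<approx> y"
  then have "(\<lambda>w. w \<approx> x) = (\<lambda>w. w \<approx> y)" using eqM_sym eqM_trans by blast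
  then show "nf x = nf y" by (simp add: nf_def)
qed

lemma range_nf: "finite (range nf)" "card (range nf) \<le> q ^ 2"
proof -
  let ?R = "insert (nf 0) ((\<lambda>i. nf (z ^ i)) ` {..<N})"
  have "nf x \<in> ?R" for x
  proof (cases "x \<in> M")
    case False
    then obtain i where "x \<approx> z ^ i" using residue by blast
    then have "nf x = nf (z ^ (i mod N))" unfolding nf_eq_iff using power_mod_N eqM_trans by blast
    then show ?thesis using N_bound by auto
  qed (simp add: nf_eq_iff eqM_0_iff)
  then have *: "range nf \<subseteq> ?R" by blast
  show "finite (range nf)" using * by (rule finite_subset) simp
  have "card (range nf) \<le> card ?R" using * by (intro card_mono) auto
  also have "\<dots> \<le> Suc (card ((\<lambda>i. nf (z ^ i)) ` {..<N}))" by (rule card_insert_le_m1) auto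
  also have "\<dots> \<le> Suc N" using card_image_le[of "{..<N}" "\<lambda>i. nf (z ^ i)"] by simp
  finally show "card (range nf) \<le> q ^ 2" using N_bound N_def by simp
qed

lemma finite_nf_subfield: "finite (nf ` subfield)"
  using range_nf(1) by (rule rev_finite_subset) auto

lemma card_nf_subfield: "card (nf ` subfield) \<le> q"
proof -
  have "nf ` subfield \<subseteq> (\<lambda>s. nf (enc s)) ` {..<q}"
  proof
    fix y assume "y \<in> nf ` subfield"
    then obtain x where x: "y = nf x" "x \<in> subfield" by blast
    then obtain s where "s < q" "enc s \<approx> x" using enc_surj by blast
    then have "y = nf (enc s)" by (simp add: x nf_eq_iff eqM_sym)
    then show "y \<in> (\<lambda>s. nf (enc s)) ` {..<q}" using \<open>s < q\<close> by blast
  qed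
  then have "card (nf ` subfield) \<le> card {..<q}" by (intro surj_card_le) auto
  then show ?thesis by simp
qed

section \<open>Interpolation and power sums\<close>

lemma lagrange_poly:
  assumes "finite S" "S \<subseteq> {..<N}" "i \<in> S" "card S < q"
  shows "\<exists>p. degree p \<le> q - 2 \<and> (\<forall>k\<in>S. poly p (z ^ k) \<approx> of_bool (k = i))"
proof -
  \<comment> \<open>This is the unnormalised Lagrange product. Its value at \<open>z ^ i\<close> is
    a product of differences of incongruent powers, hence invertible, and \<open>r\<close> rescales
    it to 1.\<close>
  define P where "P = (\<Prod>k\<in>S - {i}. [:- (z ^ k), 1:])"
  have "degree P \<le> (\<Sum>k\<in>S - {i}. degree [:- (z ^ k), 1:])"
    unfolding P_def by (rule degree_prod_sum_le[unfolded o_def]) (use assms in auto)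
  also have "\<dots> = card S - 1" using assms by simp
  finally have deg: "degree P \<le> q - 2" using assms by simp
  have P: "poly P x = (\<Prod>k\<in>S - {i}. x - z ^ k)" for x
    unfolding P_def by (simp add: poly_prod)
  have prod_notin: "(\<Prod>k\<in>T. x - z ^ k) \<notin> M" if "finite T" "\<And>k. k \<in> T \<Longrightarrow> x - z ^ k \<notin> M" for T x
    using that by (induction T rule: finite_induct) (use one_notin_M prime_M in auto)
  have "poly P (z ^ i) \<notin> M" unfolding P
  proof (rule prod_notin)
    fix k assume "k \<in> S - {i}"
    then show "z ^ i - z ^ k \<notin> M" using power_eqM_inj[of i k] assms unfolding eqM_def by auto
  qed (use assms in auto)
  then obtain r where r: "r * poly P (z ^ i) \<approx> 1" using inverse_ex by blast
  have "poly (smult r P) (z ^ k) \<approx> of_bool (k = i)" if "k \<in> S" for k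
  proof (cases "k = i")
    case False
    then have "poly P (z ^ k) = 0" unfolding P using that assms by (intro prod_zero) auto
    with False show ?thesis by simp
  qed (use r in simp)
  moreover have "degree (smult r P) \<le> q - 2" using degree_smult_le deg by (rule order_trans)
  ultimately show ?thesis by blast
qed

text \<open>This is a geometric sum whose ratio \<open>z ^ k\<close> differs from 1; multiplied by
  \<open>z ^ k - 1\<close> it becomes \<open>z ^ (N * k) - 1\<close>, which lies in the prime ideal
  \<open>M\<close>.\<close>

lemma power_sum_zero:
  assumes "\<not> N dvd k"
  shows "(\<Sum>i<N. z ^ (i * k)) \<approx> 0"
proof -
  have "(z ^ k - 1) * (\<Sum>i<N. z ^ (i * k)) = z ^ (N * k) - 1"
    using power_diff_1_eq[of "z ^ k" N] by (simp add: mult.commute flip: power_mult)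
  also have "\<dots> \<in> M" using power_eqM_1_iff[of "N * k"] by (simp add: eqM_def)
  finally show ?thesis
    using prime_M power_eqM_1_iff[of k] assms unfolding eqM_0_iff by (auto simp: eqM_def)
qed

section \<open>Parity checks and trace words\<close>

definition syndrome :: "(nat \<Rightarrow> nat) \<Rightarrow> nat \<Rightarrow> 'a" where
  "syndrome x j = (\<Sum>i<N. enc (x i) * z ^ (i * j))"

lemma syndrome_0_in_subfield: "syndrome x 0 \<in> subfield"
  unfolding syndrome_def by (intro subfield_sum) (simp add: enc_in_subfield)

text \<open>The Lagrange polynomial of a point \<open>i\<close> of \<open>S\<close> has degree at
  most \<open>q - 2\<close>, so combining the syndromes with its coefficients reads off the
  difference of the words at \<open>i\<close>.\<close>

lemma syndrome_distance:
  assumes "x \<in> words q {..<N}" "y \<in> words q {..<N}"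
    and syn: "\<And>j. j < q - 1 \<Longrightarrow> syndrome x j \<approx> syndrome y j"
    and S: "S \<subseteq> {..<N}" "card S < q" "\<And>i. i \<in> {..<N} - S \<Longrightarrow> x i = y i"
  shows "x = y"
proof -
  have "x i = y i" if i: "i \<in> S" for i
  proof -
    have fin: "finite S" using S finite_subset by blast
    obtain p where p: "degree p \<le> q - 2" "\<And>k. k \<in> S \<Longrightarrow> poly p (z ^ k) \<approx> of_bool (k = i)"
      using lagrange_poly[OF fin S(1) i S(2)] by blast
    have "enc (x i) - enc (y i) = (\<Sum>k\<in>S. if k = i then enc (x i) - enc (y i) else 0)"
      using fin i by simp
    also have "\<dots> = (\<Sum>k\<in>S. (enc (x k) - enc (y k)) * of_bool (k = i))"
      by (intro sum.cong) auto
    also have "\<dots> \<approx> (\<Sum>k\<in>S. (enc (x k) - enc (y k)) * poly p (z ^ k))"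
      by (intro eqM_sum eqM_mult eqM_sym[OF p(2)]) auto
    \<comment> \<open>Outside \<open>S\<close> the words agree, so the values of \<open>p\<close>
      there, which are not controlled, do not enter.\<close>
    also have "\<dots> = (\<Sum>k<N. (enc (x k) - enc (y k)) * poly p (z ^ k))"
      using S by (intro sum.mono_neutral_left) auto
    also have "\<dots> = (\<Sum>k<N. \<Sum>j\<le>degree p. coeff p j * ((enc (x k) - enc (y k)) * z ^ (k * j)))"
      by (simp add: poly_altdef sum_distrib_left power_mult mult_ac)
    also have "\<dots> = (\<Sum>j\<le>degree p. coeff p j * (\<Sum>k<N. (enc (x k) - enc (y k)) * z ^ (k * j)))"
      by (subst sum.swap) (simp add: sum_distrib_left)
    also have "\<dots> = (\<Sum>j\<le>degree p. coeff p j * (syndrome x j - syndrome y j))"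
      by (simp add: syndrome_def left_diff_distrib sum_subtractf)
    also have "\<dots> \<approx> (\<Sum>j\<le>degree p. coeff p j * (syndrome y j - syndrome y j))"
      using p(1) q_ge by (intro eqM_sum eqM_mult eqM_diff syn) auto
    finally have "enc (x i) \<approx> enc (y i)" by (simp add: eqM_def)
    then show ?thesis
      using assms(1,2) i S(1) by (intro enc_inj) (auto simp: words_def)
  qed
  then have "x i = y i" if "i < N" for i using S(3) that by blast
  then show ?thesis
    using assms(1,2) unfolding words_def by (intro PiE_ext[of x _ _ y]) auto
qed

text \<open>Modulo \<open>M\<close>, the shifts are the trace words of the polynomials with terms of degree
  \<open>3, \<dots>, q + 1\<close>. Since \<open>z ^ (i * (q + 1))\<close> lies in the subfield, only the trace of the
  coefficient of degree \<open>q + 1\<close> matters, which saves one symbol; the shift takes this trace as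
  its coefficient.\<close>

definition shift :: "(nat \<Rightarrow> 'a) \<Rightarrow> nat \<Rightarrow> 'a" where
  "shift c i = (\<Sum>k\<in>{3..q}. c k * z ^ (i * k) + c k ^ q * z ^ (i * (q * k)))
     + c (q + 1) * z ^ (i * (q + 1))"

lemma shift_cong:
  assumes "\<And>k. k \<in> {3..q + 1} \<Longrightarrow> c k \<approx> c' k"
  shows "shift c i \<approx> shift c' i"
  unfolding shift_def using assms q_ge by (intro eqM_add eqM_sum eqM_mult eqM_power) auto

lemma shift_add: "shift (\<lambda>k. c k + c' k) i \<approx> shift c i + shift c' i"
proof -
  have "shift (\<lambda>k. c k + c' k) i \<approx>
    (\<Sum>k\<in>{3..q}. (c k + c' k) * z ^ (i * k) + (c k ^ q + c' k ^ q) * z ^ (i * (q * k)))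
     + (c (q + 1) + c' (q + 1)) * z ^ (i * (q + 1))"
    unfolding shift_def by (intro eqM_add eqM_sum eqM_mult frobenius_add) auto
  also have "\<dots> = shift c i + shift c' i"
    by (simp add: shift_def sum.distrib distrib_right add_ac del: mult_Suc_right)
  finally show ?thesis .
qed

lemma shift_minus: "shift (\<lambda>k. - c k) i \<approx> - shift c i"
proof -
  have "shift (\<lambda>k. - c k) i \<approx>
    (\<Sum>k\<in>{3..q}. - c k * z ^ (i * k) + - (c k ^ q) * z ^ (i * (q * k)))
     + - c (q + 1) * z ^ (i * (q + 1))"
    unfolding shift_def by (intro eqM_add eqM_sum eqM_mult frobenius_minus) auto
  also have "\<dots> = - shift c i"
    by (simp add: shift_def sum_subtractf sum_negf sum.distrib)
  finally show ?thesis .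
qed

text \<open>Each summand of degree up to \<open>q\<close> is the trace of
  \<open>c k * z ^ (i * k)\<close>, and the top term is a product of two subfield elements.\<close>

lemma shift_in_subfield:
  assumes "c (q + 1) \<in> subfield"
  shows "shift c i \<in> subfield"
proof -
  have *: "c k * z ^ (i * k) + c k ^ q * z ^ (i * (q * k))
    = (c k * z ^ (i * k)) + (c k * z ^ (i * k)) ^ q" for k
    by (simp add: power_mult_distrib mult_ac flip: power_mult)
  show ?thesis unfolding shift_def *
    using assms by (intro subfield_add[of "sum _ _"] subfield_sum subfield_mult norm_in_subfield)
      (auto intro: trace_in_subfield)
qed

text \<open>This expresses that C_2 lies in C_1: adding a shift leaves all checked syndromes
  unchanged. Expanding the shift reduces it to power sums.\<close>

lemma shift_syndrome:
  assumes "j < q - 1"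
  shows "(\<Sum>i<N. shift c i * z ^ (i * j)) \<approx> 0"
proof -
  have nd: "\<not> N dvd m" if "0 < m" "m < N" for m
    using that by (auto dest: dvd_imp_le)
  have 1: "\<not> N dvd k + j" if "k \<in> {3..q + 1}" for k
    using that assms N_bound q_ge by (intro nd) auto
  \<comment> \<open>The top term carries no conjugate, so exponents of this form arise only for
    \<open>k\<close> up to \<open>q\<close>.\<close>
  have 2: "\<not> N dvd q * k + j" if "k \<in> {3..q}" for k
  proof (cases "k = q")
    case True
    \<comment> \<open>Only for \<open>k = q\<close> does the exponent exceed \<open>N\<close>; as
      \<open>q * q = N + 1\<close>, it leaves the remainder \<open>j + 1\<close>.\<close>
    have "q * q \<ge> q * 3" using q_ge by (intro mult_left_mono) auto
    then have "q * k + j = N + (j + 1)" "j + 1 < N"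
      using True assms N_bound by (auto simp: N_def power2_eq_square)
    then show ?thesis using nd[of "j + 1"] by (metis dvd_add_triv_left_iff zero_less_Suc Suc_eq_plus1)
  next
    case False
    then have "q * k \<le> q * (q - 1)" using that by (intro mult_left_mono) auto
    also have "q * (q - 1) + (q - 1) = N" unfolding N_eq using q_ge by (cases q) auto
    finally have "q * k + j < N" using assms by linarith
    then show ?thesis using that q_ge by (intro nd) auto
  qed
  have "(\<Sum>i<N. shift c i * z ^ (i * j)) =
    (\<Sum>k\<in>{3..q}. c k * (\<Sum>i<N. z ^ (i * (k + j))) + c k ^ q * (\<Sum>i<N. z ^ (i * (q * k + j))))
    + c (q + 1) * (\<Sum>i<N. z ^ (i * (q + 1 + j)))"
  proof -
    have "(\<Sum>i<N. shift c i * z ^ (i * j)) =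
      (\<Sum>i<N. (\<Sum>k\<in>{3..q}. c k * z ^ (i * (k + j)) + c k ^ q * z ^ (i * (q * k + j)))
        + c (q + 1) * z ^ (i * (q + 1 + j)))"
      unfolding shift_def distrib_right sum_distrib_right mult.assoc
      by (simp only: distrib_left power_add)
    also have "\<dots> = (\<Sum>k\<in>{3..q}. \<Sum>i<N. c k * z ^ (i * (k + j)) + c k ^ q * z ^ (i * (q * k + j)))
        + (\<Sum>i<N. c (q + 1) * z ^ (i * (q + 1 + j)))"
      by (simp only: sum.distrib[of _ _ "{..<N}"] sum.swap[of _ "{3..q}" "{..<N}"])
    finally show ?thesis by (simp only: sum.distrib sum_distrib_left)
  qed
  also have "\<dots> \<approx> (\<Sum>k\<in>{3..q}. c k * 0 + c k ^ q * 0) + c (q + 1) * 0"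
    using q_ge by (intro eqM_add eqM_sum eqM_mult power_sum_zero 1 2) auto
  finally show ?thesis by (simp only: mult_zero_right add_0_left sum.neutral_const)
qed

text \<open>Each \<open>b i\<close> is lifted to an \<open>e i\<close> of trace \<open>b i\<close>.
  The lifts are interpolated on \<open>S\<close> by X^3 times a polynomial of degree at most
  \<open>q - 2\<close>, which has only the degrees 3 to \<open>q + 1\<close> that
  \<open>shift\<close> admits; then the trace is taken.\<close>

lemma shift_interpolation:
  assumes S: "S \<subseteq> {..<N}" "card S < q" and b: "\<And>i. i \<in> S \<Longrightarrow> b i \<in> subfield"
  shows "\<exists>c. c (q + 1) \<in> subfield \<and> (\<forall>i\<in>S. shift c i \<approx> b i)"
proof -
  have fin: "finite S" using S finite_subset by blast
  obtain e where e: "\<And>i. i \<in> S \<Longrightarrow> e i + e i ^ q \<approx> b i" using trace_surj[OF b] by metis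
  \<comment> \<open>The inverses of the cubes of the nodes compensate for the factor X^3.\<close>
  have "\<forall>i. \<exists>r. r * z ^ (i * 3) \<approx> 1" using inverse_ex[OF power_notin_M] by blast
  then obtain r where r: "\<And>i. r i * z ^ (i * 3) \<approx> 1" unfolding choice_iff by blast
  have "\<forall>i\<in>S. \<exists>p. degree p \<le> q - 2 \<and> (\<forall>k\<in>S. poly p (z ^ k) \<approx> of_bool (k = i))"
    using lagrange_poly[OF fin S(1) _ S(2)] by blast
  then obtain p where p: "\<And>i. i \<in> S \<Longrightarrow> degree (p i) \<le> q - 2"
    "\<And>i k. i \<in> S \<Longrightarrow> k \<in> S \<Longrightarrow> poly (p i) (z ^ k) \<approx> of_bool (k = i)"
    unfolding bchoice_iff by blast
  define a where "a k = (\<Sum>i\<in>S. e i * r i * coeff (p i) (k - 3))" for k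
  \<comment> \<open>\<open>shift\<close> takes the trace of the top coefficient in place of the
    coefficient itself.\<close>
  define c where "c = a(q + 1 := a (q + 1) + a (q + 1) ^ q)"
  have val: "(\<Sum>k\<in>{3..q + 1}. a k * z ^ (i * k)) \<approx> e i" if i: "i \<in> S" for i
  proof -
    have poly: "(\<Sum>k\<le>q - 2. coeff (p l) k * w ^ k) = poly (p l) w" if "l \<in> S" for l w
      unfolding poly_altdef using p(1)[OF that]
      by (intro sum.mono_neutral_right) (auto simp: coeff_eq_0)
    have "(\<Sum>k\<in>{3..q + 1}. a k * z ^ (i * k)) = (\<Sum>k\<le>q - 2. a (k + 3) * z ^ (i * (k + 3)))"
      using q_ge by (intro sum.reindex_bij_witness[of _ "\<lambda>k. k + 3" "\<lambda>k. k - 3"]) auto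
    also have "\<dots> = (\<Sum>k\<le>q - 2. \<Sum>l\<in>S. e l * (r l * z ^ (i * 3)) * (coeff (p l) k * (z ^ i) ^ k))"
    proof -
      have *: "z ^ (i * (k + 3)) = z ^ (i * 3) * (z ^ i) ^ k" for k
        by (simp only: distrib_left power_add power_mult mult.commute)
      show ?thesis unfolding a_def sum_distrib_right *
        by (intro sum.cong) (simp_all add: mult_ac)
    qed
    also have "\<dots> = (\<Sum>l\<in>S. e l * (r l * z ^ (i * 3)) * (\<Sum>k\<le>q - 2. coeff (p l) k * (z ^ i) ^ k))"
      by (subst sum.swap) (simp only: sum_distrib_left)
    also have "\<dots> = (\<Sum>l\<in>S. e l * (r l * z ^ (i * 3)) * poly (p l) (z ^ i))"
      by (simp add: poly)
    also have "\<dots> \<approx> (\<Sum>l\<in>S. e l * (r l * z ^ (i * 3)) * of_bool (i = l))"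
      by (intro eqM_sum eqM_mult p(2)[OF _ i]) auto
    also have "\<dots> = (\<Sum>l\<in>S. if l = i then e i * (r i * z ^ (i * 3)) else 0)"
      by (intro sum.cong) auto
    also have "\<dots> = e i * (r i * z ^ (i * 3))" using fin i by simp
    also have "\<dots> \<approx> e i * 1" by (intro eqM_mult r) auto
    finally show ?thesis by simp
  qed
  have "shift c i \<approx> b i" if i: "i \<in> S" for i
  proof -
    let ?T = "\<Sum>k\<in>{3..q + 1}. a k * z ^ (i * k)"
    \<comment> \<open>A norm is fixed by Frobenius, so one of its two occurrences can be conjugated,
      which turns the top term into a trace like the others.\<close>
    have norm: "z ^ (i * (q + 1)) \<approx> (z ^ (i * (q + 1))) ^ q"
      using norm_in_subfield eqM_sym unfolding subfield_def by blast
    have "shift c i = (\<Sum>k\<in>{3..q}. a k * z ^ (i * k) + a k ^ q * z ^ (i * (q * k)))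
        + (a (q + 1) * z ^ (i * (q + 1)) + a (q + 1) ^ q * z ^ (i * (q + 1)))"
      unfolding shift_def by (simp add: c_def distrib_right del: mult_Suc_right)
    also have "\<dots> \<approx> (\<Sum>k\<in>{3..q}. a k * z ^ (i * k) + a k ^ q * z ^ (i * (q * k)))
        + (a (q + 1) * z ^ (i * (q + 1)) + a (q + 1) ^ q * (z ^ (i * (q + 1))) ^ q)"
      by (intro eqM_add eqM_mult norm eqM_sum) auto
    also have "\<dots> = (\<Sum>k\<in>insert (q + 1) {3..q}. a k * z ^ (i * k) + (a k * z ^ (i * k)) ^ q)"
    proof -
      have "z ^ (i * (q * k)) = (z ^ (i * k)) ^ q" for k by (simp add: mult_ac flip: power_mult)
      then show ?thesis by (simp add: power_mult_distrib del: mult_Suc_right)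
    qed
    also have "insert (q + 1) {3..q} = {3..q + 1}" using q_ge by auto
    also have "(\<Sum>k\<in>{3..q + 1}. a k * z ^ (i * k) + (a k * z ^ (i * k)) ^ q)
        \<approx> ?T + ?T ^ q"
      unfolding sum.distrib by (intro eqM_add eqM_sym[OF frobenius_sum]) auto
    also have "\<dots> \<approx> e i + e i ^ q" by (intro eqM_add eqM_power val i)
    also have "\<dots> \<approx> b i" by (rule e[OF i])
    finally show ?thesis .
  qed
  moreover have "c (q + 1) \<in> subfield" by (simp add: c_def trace_in_subfield)
  ultimately show ?thesis by blast
qed

text \<open>This is the coset of C_2 through \<open>x\<close>. The alphabet has no addition of its
  own, so the coset is formed through \<open>enc\<close> modulo \<open>M\<close>.\<close>

definition orbit :: "(nat \<Rightarrow> nat) \<Rightarrow> (nat \<Rightarrow> nat) set" where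
  "orbit x = {y \<in> words q {..<N}.
     \<exists>c. c (q + 1) \<in> subfield \<and> (\<forall>i<N. enc (y i) \<approx> enc (x i) + shift c i)}"

lemma orbit_self: "x \<in> words q {..<N} \<Longrightarrow> x \<in> orbit x"
  unfolding orbit_def
  using q_ge by (auto intro!: exI[of _ "\<lambda>_. 0"] simp: shift_def zero_power_q subfield_0)

lemma orbit_sym:
  assumes "y \<in> orbit x" "x \<in> words q {..<N}"
  shows "x \<in> orbit y"
proof -
  obtain c where c: "c (q + 1) \<in> subfield" "\<And>i. i < N \<Longrightarrow> enc (y i) \<approx> enc (x i) + shift c i"
    using assms unfolding orbit_def by blast
  have "enc (x i) \<approx> enc (y i) + shift (\<lambda>k. - c k) i" if "i < N" for i
  proof -
    have "enc (y i) + shift (\<lambda>k. - c k) i \<approx> enc (x i) + shift c i + - shift c i"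
      by (intro eqM_add c that shift_minus)
    from eqM_sym[OF this] show ?thesis by simp
  qed
  then show ?thesis unfolding orbit_def using assms(2) subfield_minus[OF c(1)]
    by (auto intro!: exI[of _ "\<lambda>k. - c k"])
qed

lemma orbit_trans:
  assumes "y \<in> orbit x" "w \<in> orbit y"
  shows "w \<in> orbit x"
proof -
  obtain c where c: "c (q + 1) \<in> subfield" "\<And>i. i < N \<Longrightarrow> enc (y i) \<approx> enc (x i) + shift c i"
    using assms unfolding orbit_def by blast
  obtain c' where c': "c' (q + 1) \<in> subfield" "\<And>i. i < N \<Longrightarrow> enc (w i) \<approx> enc (y i) + shift c' i"
    using assms unfolding orbit_def by blast
  have "enc (w i) \<approx> enc (x i) + shift (\<lambda>k. c k + c' k) i" if "i < N" for i
  proof -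
    have "enc (w i) \<approx> enc (y i) + shift c' i" using c' that by blast
    also have "\<dots> \<approx> enc (x i) + shift c i + shift c' i" by (intro eqM_add c that) auto
    also have "\<dots> = enc (x i) + (shift c i + shift c' i)" by (rule add.assoc)
    also have "\<dots> \<approx> enc (x i) + shift (\<lambda>k. c k + c' k) i"
      by (intro eqM_add eqM_sym[OF shift_add]) auto
    finally show ?thesis .
  qed
  then show ?thesis unfolding orbit_def using assms(2) subfield_add[OF c(1) c'(1)]
    by (auto simp: orbit_def intro!: exI[of _ "\<lambda>k. c k + c' k"])
qed

lemma orbit_eq: "y \<in> orbit x \<Longrightarrow> x \<in> words q {..<N} \<Longrightarrow> orbit y = orbit x"
  using orbit_trans[of y x] orbit_trans[OF orbit_sym[of y x]] by blast

lemma enc_word_inj: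
  assumes "x \<in> words q {..<N}" "y \<in> words q {..<N}" "\<And>i. i < N \<Longrightarrow> enc (x i) \<approx> enc (y i)"
  shows "x = y"
proof -
  have "x i = y i" if "i < N" for i
    using assms that by (intro enc_inj) (auto simp: words_def)
  then show ?thesis
    using assms(1,2) unfolding words_def by (intro PiE_ext[of x _ _ y]) auto
qed

lemma word_ex:
  assumes "\<And>i. i < N \<Longrightarrow> f i \<in> subfield"
  shows "\<exists>x\<in>words q {..<N}. \<forall>i<N. enc (x i) \<approx> f i"
proof -
  have "\<forall>i\<in>{..<N}. \<exists>s. s < q \<and> enc s \<approx> f i" using enc_surj[OF assms] by blast
  then obtain s where s: "\<forall>i\<in>{..<N}. s i < q \<and> enc (s i) \<approx> f i" unfolding bchoice_iff by blast
  show ?thesis using s by (intro bexI[of _ "restrict s {..<N}"]) (auto simp: words_def)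
qed

lemma orbit_syndrome:
  assumes "y \<in> orbit x" "j < q - 1"
  shows "syndrome y j \<approx> syndrome x j"
proof -
  obtain c where c: "\<And>i. i < N \<Longrightarrow> enc (y i) \<approx> enc (x i) + shift c i"
    using assms unfolding orbit_def by blast
  have "syndrome y j \<approx> (\<Sum>i<N. (enc (x i) + shift c i) * z ^ (i * j))"
    unfolding syndrome_def by (intro eqM_sum eqM_mult c) auto
  also have "\<dots> = syndrome x j + (\<Sum>i<N. shift c i * z ^ (i * j))"
    by (simp add: syndrome_def distrib_right sum.distrib)
  also have "\<dots> \<approx> syndrome x j + 0" using assms by (intro eqM_add shift_syndrome) auto
  finally show ?thesis by simp
qed

section \<open>Counting, and assembly of the code\<close>

lemma card_orbit_le: "card (orbit x) \<le> q ^ (2 * q - 3)"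
proof -
  \<comment> \<open>Normalised coefficients determine the word: at most \<open>q\<close> values for
    the degree \<open>q + 1\<close>, and at most \<open>q ^ 2\<close> for each of the
    \<open>q - 2\<close> degrees from 3 to \<open>q\<close>.\<close>
  define P where "P = (\<Pi>\<^sub>E k\<in>insert (q + 1) {3..q}. if k = q + 1 then nf ` subfield else range nf)"
  define T where "T c = (THE y. y \<in> words q {..<N} \<and> (\<forall>i<N. enc (y i) \<approx> enc (x i) + shift c i))" for c
  have fin: "finite P" unfolding P_def using range_nf(1) finite_nf_subfield
    by (intro finite_PiE) auto
  have "orbit x \<subseteq> T ` P"
  proof
    fix y assume "y \<in> orbit x"
    then obtain c where y: "y \<in> words q {..<N}" and c: "c (q + 1) \<in> subfield"
      "\<And>i. i < N \<Longrightarrow> enc (y i) \<approx> enc (x i) + shift c i"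
      unfolding orbit_def by blast
    define c' where "c' = (\<lambda>k\<in>insert (q + 1) {3..q}. nf (c k))"
    have eq: "enc (y i) \<approx> enc (x i) + shift c' i" if "i < N" for i
    proof -
      have "shift c i \<approx> shift c' i"
      proof (rule shift_cong)
        fix k assume "k \<in> {3..q + 1}"
        then have "c' k = nf (c k)" by (auto simp: c'_def)
        then show "c k \<approx> c' k" by (simp add: nf_eqM eqM_sym)
      qed
      then show ?thesis using c(2)[OF that] eqM_add[OF eqM_refl] eqM_trans by blast
    qed
    have "T c' = y" unfolding T_def
    proof (rule the_equality)
      fix w assume w: "w \<in> words q {..<N} \<and> (\<forall>i<N. enc (w i) \<approx> enc (x i) + shift c' i)"
      then have "enc (w i) \<approx> enc (y i)" if "i < N" for i
        using eq[OF that] eqM_sym eqM_trans that by blast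
      with w y show "w = y" by (intro enc_word_inj) auto
    qed (use y eq in blast)
    moreover have "c' \<in> P" unfolding P_def c'_def using c(1) by auto
    ultimately show "y \<in> T ` P" by blast
  qed
  then have "card (orbit x) \<le> card P" using fin by (rule surj_card_le[rotated])
  also have "card P = card (nf ` subfield) * card (range nf) ^ (q - 2)"
  proof -
    have "(\<Prod>k\<in>{3..q}. card (if k = q + 1 then nf ` subfield else range nf))
        = (\<Prod>k\<in>{3..q}. card (range nf))" by (intro prod.cong) auto
    then show ?thesis unfolding P_def by (simp add: card_PiE)
  qed
  also have "\<dots> \<le> q * (q ^ 2) ^ (q - 2)"
    by (intro mult_mono power_mono card_nf_subfield range_nf) auto
  also have "\<dots> = q ^ Suc (2 * (q - 2))" by (simp flip: power_mult)
  also have "Suc (2 * (q - 2)) = 2 * q - 3" using q_ge by simp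
  finally show ?thesis .
qed

text \<open>The syndrome for \<open>j = 0\<close> lies in the subfield and the other
  \<open>q - 2\<close> have at most \<open>q ^ 2\<close> classes each, so by pigeonhole some fibre
  is large. It inherits the distance bound of C_1 and, like C_1, is closed under shifts.\<close>

lemma large_fibre:
  "\<exists>X \<subseteq> words q {..<N}. q ^ N \<le> q ^ (2 * q - 3) * card X \<and>
     (\<forall>x\<in>X. \<forall>y\<in>words q {..<N}. y \<in> X \<longleftrightarrow> (\<forall>j<q - 1. syndrome x j \<approx> syndrome y j))"
proof -
  define P where "P = (\<Pi>\<^sub>E j\<in>{..<q - 1}. if j = 0 then nf ` subfield else range nf)"
  define f where "f x = (\<lambda>j\<in>{..<q - 1}. nf (syndrome x j))" for x
  have fin: "finite P" unfolding P_def using range_nf(1) finite_nf_subfield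
    by (intro finite_PiE) auto
  have "f ` words q {..<N} \<subseteq> P"
    unfolding P_def f_def using syndrome_0_in_subfield
    by (intro image_subsetI restrict_PiE_iff[THEN iffD2] ballI) auto
  moreover have "words q {..<N} \<noteq> {}" using q_ge by (auto simp: words_def PiE_eq_empty_iff lessThan_empty_iff)
  ultimately obtain b where b: "card (words q {..<N}) \<le> card P * card {x\<in>words q {..<N}. f x = b}"
    using pigeonhole_fibre[OF finite_words fin] by blast
  have "card P = card (nf ` subfield) * card (range nf) ^ (q - 2)"
  proof -
    have ins: "{..<q - 1} = insert 0 {1..<q - 1}" using q_ge by auto
    have "(\<Prod>j\<in>{1..<q - 1}. card (if j = 0 then nf ` subfield else range nf))
        = (\<Prod>j\<in>{1..<q - 1}. card (range nf))" by (intro prod.cong) auto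
    then show ?thesis unfolding P_def ins by (simp add: card_PiE numeral_2_eq_2)
  qed
  also have "\<dots> \<le> q * (q ^ 2) ^ (q - 2)"
    by (intro mult_mono power_mono card_nf_subfield range_nf) auto
  also have "\<dots> = q ^ Suc (2 * (q - 2))" by (simp flip: power_mult)
  also have "Suc (2 * (q - 2)) = 2 * q - 3" using q_ge by simp
  finally have bound: "card P * card {x\<in>words q {..<N}. f x = b}
      \<le> q ^ (2 * q - 3) * card {x\<in>words q {..<N}. f x = b}"
    by (rule mult_right_mono) simp
  have card_words: "card (words q {..<N}) = q ^ N" by (simp add: words_def card_PiE)
  have f: "f x = f y \<longleftrightarrow> (\<forall>j<q - 1. syndrome x j \<approx> syndrome y j)" for x y
    by (auto simp: f_def fun_eq_iff nf_eq_iff restrict_def)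
  have "q ^ N \<le> q ^ (2 * q - 3) * card {x\<in>words q {..<N}. f x = b}"
    using order_trans[OF b bound] unfolding card_words .
  moreover have "y \<in> {x\<in>words q {..<N}. f x = b} \<longleftrightarrow> (\<forall>j<q - 1. syndrome x j \<approx> syndrome y j)"
    if "x \<in> {x\<in>words q {..<N}. f x = b}" "y \<in> words q {..<N}" for x y
    unfolding f[symmetric] using that by auto
  ultimately show ?thesis by (intro exI[of _ "{x\<in>words q {..<N}. f x = b}"]) blast
qed

text \<open>Orbits partition the fibre \<open>X\<close> into classes of at most
  \<open>q ^ (2 * q - 3)\<close> words, so there are at least as many orbits as the dimension
  requires.\<close>

lemma quantum_code_ex: "\<exists>Q. quantum_code q N (N - 2 * (2 * q - 3)) q Q"
proof -
  let ?r = "2 * q - 3"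
  obtain X where X: "X \<subseteq> words q {..<N}" "q ^ N \<le> q ^ ?r * card X"
    "\<And>x y. x \<in> X \<Longrightarrow> y \<in> words q {..<N} \<Longrightarrow> y \<in> X \<longleftrightarrow> (\<forall>j<q - 1. syndrome x j \<approx> syndrome y j)"
    using large_fibre by blast
  have finX: "finite X" using finite_subset[OF X(1) finite_words] by blast
  have orbit_X: "orbit x \<subseteq> X" if "x \<in> X" for x
  proof
    fix y assume y: "y \<in> orbit x"
    then have "y \<in> words q {..<N}" by (simp add: orbit_def)
    then show "y \<in> X" using X(3)[OF that] orbit_syndrome[OF y] eqM_sym by blast
  qed
  have "card X \<le> card (\<Union>(orbit ` X))"
    using orbit_self X(1) orbit_X finite_subset[OF _ finX] by (intro card_mono) auto
  also have "\<dots> \<le> (\<Sum>D\<in>orbit ` X. card D)"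
    using orbit_X finite_subset[OF _ finX] by (intro card_Union_le_sum_card)
  also have "\<dots> \<le> card (orbit ` X) * q ^ ?r"
    using sum_bounded_above[of "orbit ` X" card "q ^ ?r"] card_orbit_le by auto
  finally have "q ^ N \<le> q ^ ?r * (card (orbit ` X) * q ^ ?r)"
    using X(2) by (meson mult_le_mono2 order_trans)
  moreover have "N = (N - 2 * ?r) + (?r + ?r)"
  proof -
    have "N - 2 * ?r + 2 * ?r = N" if "2 * ?r \<le> N" using that by simp
    moreover have "2 * ?r \<le> N"
    proof -
      obtain k where k: "q = k + 3" using q_ge by (metis le_add_diff_inverse2)
      show ?thesis unfolding N_def k by (simp add: power2_eq_square algebra_simps)
    qed
    ultimately show ?thesis by simp
  qed
  ultimately have "q ^ (N - 2 * ?r) * (q ^ ?r * q ^ ?r) \<le> card (orbit ` X) * (q ^ ?r * q ^ ?r)"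
    by (metis (no_types, lifting) mult.assoc mult.commute power_add)
  then have "q ^ (N - 2 * ?r) \<le> card (orbit ` X)" using q_ge by simp
  \<comment> \<open>Exactly this many orbits are kept because the dimension is prescribed; distance
    and strength hold for any selection of them.\<close>
  then obtain \<D> where D: "\<D> \<subseteq> orbit ` X" "card \<D> = q ^ (N - 2 * ?r)" "finite \<D>"
    using obtain_subset_with_card_n by blast
  have sub: "D \<subseteq> X" if "D \<in> \<D>" for D using that D(1) orbit_X by blast
  interpret word_family q N "N - 2 * ?r" q \<D>
  proof
    fix D assume DD: "D \<in> \<D>"
    then show "D \<subseteq> words q {..<N}" using sub X(1) by blast
    show "D \<noteq> {}" using DD D(1) orbit_self X(1) by auto
  next
    fix D D' w assume *: "D \<in> \<D>" "D' \<in> \<D>" "w \<in> D" "w \<in> D'"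
    then obtain x y where "D = orbit x" "D' = orbit y" "x \<in> X" "y \<in> X" using D(1) by blast
    then show "D = D'" using * orbit_eq X(1) by blast
  next
    fix x y S assume *: "x \<in> \<Union>\<D>" "y \<in> \<Union>\<D>" "S \<subseteq> {..<N}" "card S < q"
      "\<And>i. i \<in> {..<N} - S \<Longrightarrow> x i = y i"
    then have xy: "x \<in> X" "y \<in> X" using sub by auto
    then have words: "x \<in> words q {..<N}" "y \<in> words q {..<N}" using X(1) by auto
    have "syndrome x j \<approx> syndrome y j" if "j < q - 1" for j
      using X(3)[OF xy(1) words(2)] xy(2) that by blast
    then show "x = y" using *(3,4,5) by (rule syndrome_distance[OF words])
  next
    fix D D' S assume *: "D \<in> \<D>" "D' \<in> \<D>" "S \<subseteq> {..<N}" "card S < q"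
    obtain x y where xy: "D = orbit x" "D' = orbit y" "x \<in> X" "y \<in> X" using D(1) * by blast
    obtain c where c: "c (q + 1) \<in> subfield" "\<And>i. i \<in> S \<Longrightarrow> shift c i \<approx> enc (y i) - enc (x i)"
      using shift_interpolation[OF *(3,4), of "\<lambda>i. enc (y i) - enc (x i)"]
      by (auto intro: subfield_diff enc_in_subfield)
    \<comment> \<open>Adding \<open>g\<close> carries the orbit of \<open>x\<close> to that of
      \<open>y\<close>, as \<open>g\<close> is their difference up to a shift, and fixes the
      coordinates in \<open>S\<close>, where \<open>g\<close> vanishes modulo
      \<open>M\<close>.\<close>
    define g where "g i = enc (y i) - enc (x i) - shift c i" for i
    have g: "g i \<in> subfield" for i
      unfolding g_def by (intro subfield_diff enc_in_subfield shift_in_subfield c)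
    have "\<forall>w. \<exists>v\<in>words q {..<N}. \<forall>i<N. enc (v i) \<approx> enc (w i) + g i"
      by (intro allI word_ex subfield_add enc_in_subfield g)
    then obtain h where h: "\<And>w. h w \<in> words q {..<N}" "\<And>w i. i < N \<Longrightarrow> enc (h w i) \<approx> enc (w i) + g i"
      by metis
    have inj: "inj_on h D"
    proof (rule inj_onI)
      fix v w assume vw: "v \<in> D" "w \<in> D" "h v = h w"
      have "enc (v i) \<approx> enc (w i)" if "i < N" for i
      proof -
        have "enc (v i) + g i \<approx> enc (w i) + g i"
          using h(2)[OF that, of v] h(2)[OF that, of w] eqM_sym eqM_trans unfolding vw(3) by blast
        then have "enc (v i) + g i - g i \<approx> enc (w i) + g i - g i" by (intro eqM_diff) auto
        then show ?thesis by simp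
      qed
      then show "v = w" using vw sub[OF *(1)] X(1) by (intro enc_word_inj) auto
    qed
    have "h w \<in> D'" if w: "w \<in> D" for w
    proof -
      obtain c' where c': "c' (q + 1) \<in> subfield" "\<And>i. i < N \<Longrightarrow> enc (w i) \<approx> enc (x i) + shift c' i"
        using w unfolding xy orbit_def by blast
      let ?c = "\<lambda>k. c' k + - c k"
      have "enc (h w i) \<approx> enc (y i) + shift ?c i" if "i < N" for i
      proof -
        have "enc (h w i) \<approx> enc (w i) + g i" by (rule h(2)[OF that])
        also have "\<dots> \<approx> enc (x i) + shift c' i + g i" by (intro eqM_add c' that) auto
        also have "\<dots> = enc (y i) + (shift c' i + - shift c i)" by (simp add: g_def)
        also have "\<dots> \<approx> enc (y i) + (shift c' i + shift (\<lambda>k. - c k) i)"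
          by (intro eqM_add eqM_sym[OF shift_minus]) auto
        also have "\<dots> \<approx> enc (y i) + shift ?c i" by (intro eqM_add eqM_sym[OF shift_add]) auto
        finally show ?thesis .
      qed
      moreover have "?c (q + 1) \<in> subfield" by (intro subfield_add subfield_minus c c')
      ultimately show ?thesis unfolding xy orbit_def
        by (intro CollectI conjI exI[of _ ?c] allI impI h(1))
    qed
    moreover have "h w i = w i" if w: "w \<in> D" and i: "i \<in> S" for w i
    proof (rule enc_inj)
      have "i < N" using i * by auto
      then show "h w i < q" using h(1)[of w] by (auto simp: words_def)
      show "w i < q" using \<open>i < N\<close> w sub[OF *(1)] X(1) by (fastforce simp: words_def)
      have "enc (h w i) \<approx> enc (w i) + g i" using h(2) \<open>i < N\<close> by blast
      also have "\<dots> \<approx> enc (w i) + (enc (y i) - enc (x i) - (enc (y i) - enc (x i)))"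
        unfolding g_def by (intro eqM_add eqM_diff c i) auto
      finally show "enc (h w i) \<approx> enc (w i)" by simp
    qed
    ultimately show "\<exists>h. inj_on h D \<and> h ` D \<subseteq> D' \<and> (\<forall>x\<in>D. \<forall>i\<in>S. h x i = x i)"
      using inj by blast
  qed (use D q_ge in auto)
  show ?thesis using quantum_code_Q by blast
qed

end

section \<open>Existence of the residue field\<close>

text \<open>Modulo \<open>p\<close>, the matrix \<open>1 - p G\<close> is the identity, so its determinant does not vanish.\<close>

lemma integer_eigenvector_zero:
  fixes G :: "nat \<Rightarrow> nat \<Rightarrow> int" and v :: "nat \<Rightarrow> complex" and p :: int
  assumes p: "p > 1" and v: "\<And>i. i < n \<Longrightarrow> v i = of_int p * (\<Sum>j<n. of_int (G i j) * v j)"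
    and "i < n"
  shows "v i = 0"
proof -
  define A where "A = mat n n (\<lambda>(i, j). of_bool (i = j) - p * G i j)"
  have A: "A \<in> carrier_mat n n" by (simp add: A_def)
  have "[det A = det (1\<^sub>m n)] (mod p)"
    unfolding det_def'[OF A] det_def'[OF one_carrier_mat]
  proof (intro cong_sum cong_mult cong_prod cong_refl)
    fix \<sigma> i assume "\<sigma> \<in> {\<sigma>. \<sigma> permutes {0..<n}}" "i \<in> {0..<n}"
    then have "\<sigma> i < n" "i < n" using permutes_in_image by fastforce+
    then show "[A $$ (i, \<sigma> i) = 1\<^sub>m n $$ (i, \<sigma> i)] (mod p)"
      by (simp add: A_def cong_iff_dvd_diff)
  qed
  then have "det A \<noteq> 0" using p by (auto simp: cong_def)
  then have "det (map_mat of_int A :: complex mat) \<noteq> 0" by simp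
  moreover have "map_mat of_int A *\<^sub>v vec n v = (0\<^sub>v n :: complex vec)"
  proof (rule eq_vecI)
    fix k assume "k < dim_vec (0\<^sub>v n :: complex vec)"
    then have k: "k < n" by simp
    have "(map_mat of_int A *\<^sub>v vec n v) $ k = (\<Sum>j<n. of_int (of_bool (k = j) - p * G k j) * v j)"
      using k by (simp add: A_def scalar_prod_def atLeast0LessThan)
    also have "\<dots> = (\<Sum>j<n. if j = k then v k else 0) - of_int p * (\<Sum>j<n. of_int (G k j) * v j)"
      unfolding sum_distrib_left sum_subtractf[symmetric] by (intro sum.cong) (auto simp: algebra_simps)
    also have "\<dots> = 0" using k v[OF k] by simp
    finally show "(map_mat of_int A *\<^sub>v vec n v) $ k = 0\<^sub>v n $ k" using k by simp
  qed (simp add: A_def)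
  ultimately have "vec n v = 0\<^sub>v n"
    using det_0_iff_vec_prod_zero_field[of "map_mat of_int A :: complex mat" n] A vec_carrier[of n v]
    by (metis map_carrier_mat)
  then have "vec n v $ i = 0\<^sub>v n $ i" by simp
  then show ?thesis using assms(3) by simp
qed

section \<open>Frobenius and prime ideals\<close>

lemma (in comm_ring_ideal) freshmans_dream_prime:
  assumes "prime p" "of_nat p \<in> M"
  shows "(x + y) ^ p \<approx> x ^ p + y ^ p"
proof -
  have p: "p > 0" using assms(1) by (rule prime_gt_0_nat)
  have "(x + y) ^ p = (\<Sum>k\<in>insert 0 (insert p {0<..<p}). of_nat (p choose k) * x ^ k * y ^ (p - k))"
    unfolding binomial_ring by (rule sum.cong) (use p in auto)
  also have "\<dots> = x ^ p + y ^ p + (\<Sum>k\<in>{0<..<p}. of_nat (p choose k) * x ^ k * y ^ (p - k))"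
    using p by simp
  also have "\<dots> \<approx> x ^ p + y ^ p + (\<Sum>k\<in>{0<..<p}. 0)"
  proof (intro eqM_add eqM_sum eqM_refl)
    fix k assume "k \<in> {0<..<p}"
    then have "p dvd p choose k" using assms(1) by (intro dvd_choose_prime) auto
    then obtain m where "p choose k = p * m" by blast
    then have "of_nat (p choose k) * x ^ k * y ^ (p - k) = (of_nat m * x ^ k * y ^ (p - k)) * of_nat p"
      by (simp add: mult_ac)
    then show "of_nat (p choose k) * x ^ k * y ^ (p - k) \<approx> 0"
      using mult_M[OF assms(2)] by (simp add: eqM_0_iff)
  qed
  finally show ?thesis by simp
qed

lemma (in comm_ring_ideal) freshmans_dream_prime_power:
  assumes "prime p" "of_nat p \<in> M"
  shows "(x + y) ^ (p ^ k) \<approx> x ^ (p ^ k) + y ^ (p ^ k)"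
proof (induction k)
  case (Suc k)
  have "(x + y) ^ (p ^ Suc k) = ((x + y) ^ (p ^ k)) ^ p" by (simp add: mult.commute flip: power_mult)
  also have "\<dots> \<approx> (x ^ (p ^ k) + y ^ (p ^ k)) ^ p" by (intro eqM_power Suc.IH)
  also have "\<dots> \<approx> (x ^ (p ^ k)) ^ p + (y ^ (p ^ k)) ^ p" by (rule freshmans_dream_prime[OF assms])
  also have "\<dots> = x ^ (p ^ Suc k) + y ^ (p ^ Suc k)" by (simp add: mult.commute flip: power_mult)
  finally show ?case .
qed simp

text \<open>By Zorn's lemma \<open>J\<close> lies in an ideal that is maximal among the proper ones
  containing it, and such an ideal is prime.\<close>

lemma comm_ring_ideal_prime_extension:
  assumes "comm_ring_ideal J" "1 \<notin> J"
  shows "\<exists>M. comm_ring_ideal M \<and> J \<subseteq> M \<and> 1 \<notin> M \<and> (\<forall>x y. x * y \<in> M \<longrightarrow> x \<in> M \<or> y \<in> M)"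
proof -
  define \<A> where "\<A> = {I. comm_ring_ideal I \<and> J \<subseteq> I \<and> 1 \<notin> I}"
  have "\<A> \<noteq> {}" using assms by (auto simp: \<A>_def)
  moreover have "\<Union>\<C> \<in> \<A>" if "\<C> \<noteq> {}" and chain: "subset.chain \<A> \<C>" for \<C>
  proof -
    have \<C>: "\<And>I. I \<in> \<C> \<Longrightarrow> comm_ring_ideal I \<and> J \<subseteq> I \<and> 1 \<notin> I"
      using chain by (auto simp: subset.chain_def \<A>_def)
    have "comm_ring_ideal (\<Union>\<C>)"
    proof
      show "0 \<in> \<Union>\<C>" using that(1) \<C> comm_ring_ideal.zero_M by blast
      show "r * x \<in> \<Union>\<C>" if "x \<in> \<Union>\<C>" for x r using that \<C> comm_ring_ideal.mult_M by blast
      fix x y assume "x \<in> \<Union>\<C>" "y \<in> \<Union>\<C>"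
      then obtain I where "I \<in> \<C>" "x \<in> I" "y \<in> I"
        using chain unfolding subset.chain_def by blast
      then show "x + y \<in> \<Union>\<C>" using \<C> comm_ring_ideal.add_M by blast
    qed
    then show ?thesis using \<C> that(1) by (auto simp: \<A>_def)
  qed
  ultimately obtain M where M: "M \<in> \<A>" "\<And>I. I \<in> \<A> \<Longrightarrow> M \<subseteq> I \<Longrightarrow> I = M"
    using subset_Zorn_nonempty[of \<A>] by metis
  interpret comm_ring_ideal M using M(1) by (simp add: \<A>_def)
  have "y \<in> M" if xy: "x * y \<in> M" and x: "x \<notin> M" for x y
  proof -
    \<comment> \<open>The ideal generated by \<open>M\<close> and \<open>x\<close> is strictly
      larger than \<open>M\<close>, hence contains 1; multiplying the resulting representation of 1
      by \<open>y\<close> puts \<open>y\<close> into \<open>M\<close>.\<close>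
    define I where "I = {m + r * x | m r. m \<in> M}"
    have I: "m + r * x \<in> I" if "m \<in> M" for m r using that by (auto simp: I_def)
    have "comm_ring_ideal I"
    proof
      show "0 \<in> I" using I[OF zero_M, of 0] by simp
      fix a b assume "a \<in> I" "b \<in> I"
      then obtain m r m' r' where "a = m + r * x" "b = m' + r' * x" "m \<in> M" "m' \<in> M"
        by (auto simp: I_def)
      then show "a + b \<in> I" using I[OF add_M, of m m' "r + r'"] by (simp add: algebra_simps)
    next
      fix a s assume "a \<in> I"
      then obtain m r where "a = m + r * x" "m \<in> M" by (auto simp: I_def)
      then show "s * a \<in> I" using I[OF mult_M, of m s "s * r"] by (simp add: algebra_simps)
    qed
    moreover have "M \<subseteq> I" using I[of _ 0] by auto
    moreover have "x \<in> I" using I[OF zero_M, of 1] by simp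
    ultimately have "1 \<in> I" using M x by (auto simp: \<A>_def)
    then obtain m r where mr: "1 = m + r * x" "m \<in> M" by (auto simp: I_def)
    then have "y = y * m + r * (x * y)" by (metis (no_types, opaque_lifting) distrib_right mult.assoc mult.commute mult_1)
    then show "y \<in> M" using add_M[OF mult_M[OF mr(2)] mult_M[OF xy]] by metis
  qed
  then show ?thesis using M(1) by (auto simp: \<A>_def)
qed

section \<open>The ring generated by a root of unity\<close>

locale unity_root =
  fixes \<zeta> :: complex and N :: nat
  assumes N_pos: "N > 0" and root: "\<zeta> ^ N = 1" and primitive: "inj_on (\<lambda>i. \<zeta> ^ i) {..<N}"
begin

text \<open>The ring generated by the root is handled through integer polynomials: its ideals
  correspond to the ideals of \<open>int poly\<close> that contain the kernel of
  \<open>ev\<close>.\<close>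

definition ev :: "int poly \<Rightarrow> complex" where
  "ev f = poly (map_poly of_int f) \<zeta>"

lemma ev_simps [simp]:
  "ev 0 = 0" "ev 1 = 1" "ev (f + g) = ev f + ev g" "ev (f - g) = ev f - ev g"
  "ev (f * g) = ev f * ev g" "ev (f ^ k) = ev f ^ k" "ev [:0, 1:] = \<zeta>" "ev (of_nat k) = of_nat k"
  by (simp_all add: ev_def hom_distribs)

lemma ev_sum: "ev (sum f I) = (\<Sum>i\<in>I. ev (f i))"
  by (induction I rule: infinite_finite_induct) auto

lemma ev_prod: "ev (prod f I) = (\<Prod>i\<in>I. ev (f i))"
  by (induction I rule: infinite_finite_induct) auto

lemma power_root_mod: "\<zeta> ^ i = \<zeta> ^ (i mod N)"
proof -
  have "\<zeta> ^ i = \<zeta> ^ (N * (i div N)) * \<zeta> ^ (i mod N)" by (simp flip: power_add)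
  then show ?thesis by (simp add: power_mult root)
qed

text \<open>The powers of \<open>\<zeta>\<close> would form an eigenvector, with eigenvalue \<open>1 / p\<close>, of the integer matrix of
  multiplication by \<open>ev g\<close>.\<close>

lemma prime_times_ev_neq_1:
  assumes "prime (p :: nat)"
  shows "of_nat p * ev g \<noteq> 1"
proof
  assume g: "of_nat p * ev g = 1"
  \<comment> \<open>Row \<open>i\<close> expands \<open>ev g * \<zeta> ^ i\<close> in powers of the
    root, with exponents reduced modulo \<open>N\<close>.\<close>
  define G where "G i j = (\<Sum>k\<in>{k\<in>{..degree g}. (i + k) mod N = j}. coeff g k)" for i j
  have eigen: "\<zeta> ^ i = of_int (int p) * (\<Sum>j<N. of_int (G i j) * \<zeta> ^ j)" for i
  proof -
    have "ev g * \<zeta> ^ i = (\<Sum>k\<le>degree g. of_int (coeff g k) * \<zeta> ^ (i + k))"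
      by (simp add: ev_def poly_altdef of_int_hom.degree_map_poly_hom sum_distrib_left sum_distrib_right power_add mult_ac)
    also have "\<dots> = (\<Sum>k\<le>degree g. of_int (coeff g k) * \<zeta> ^ ((i + k) mod N))"
      by (subst power_root_mod) simp
    also have "\<dots> = (\<Sum>j<N. \<Sum>k\<in>{k\<in>{..degree g}. (i + k) mod N = j}. of_int (coeff g k) * \<zeta> ^ ((i + k) mod N))"
      by (intro sum.group[symmetric]) (use N_pos in auto)
    also have "\<dots> = (\<Sum>j<N. of_int (G i j) * \<zeta> ^ j)"
      by (intro sum.cong) (auto simp: G_def sum_distrib_right)
    finally have "of_nat p * (ev g * \<zeta> ^ i) = of_int (int p) * (\<Sum>j<N. of_int (G i j) * \<zeta> ^ j)" by simp
    moreover have "of_nat p * (ev g * \<zeta> ^ i) = \<zeta> ^ i" using g by (simp flip: mult.assoc)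
    ultimately show ?thesis by simp
  qed
  \<comment> \<open>The entry of the eigenvector at index 0 is 1, so it cannot vanish.\<close>
  have "\<zeta> ^ 0 = 0"
  proof (rule integer_eigenvector_zero[of "int p" N "\<lambda>i. \<zeta> ^ i" G 0])
    show "int p > 1" using prime_gt_1_nat[OF assms] by simp
  qed (rule eigen, rule N_pos)
  then show False by simp
qed

text \<open>Both sides are monic polynomials in \<open>w\<close> of degree \<open>N\<close> and
  agree at the \<open>N\<close> distinct powers of the root.\<close>

lemma prod_diff_root: "(\<Prod>i<N. w - \<zeta> ^ i) = w ^ N - 1"
proof -
  define P where "P = (\<Prod>i<N. [:- (\<zeta> ^ i), 1:])"
  have deg: "degree P = N" unfolding P_def by (subst degree_prod_eq_sum_degree) auto
  have "P = monom 1 N - 1"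
  proof (rule poly_eqI_degree_lead_coeff[of _ N _ "(\<lambda>i. \<zeta> ^ i) ` {..<N}"])
    have "coeff P N = lead_coeff P" by (simp add: deg)
    also have "\<dots> = 1" unfolding P_def by (simp add: lead_coeff_prod)
    finally show "coeff P N = coeff (monom 1 N - 1) N" using N_pos by simp
    show "N \<le> card ((\<lambda>i. \<zeta> ^ i) ` {..<N})" using primitive by (simp add: card_image)
    show "degree (monom 1 N - 1 :: complex poly) \<le> N" by (intro degree_diff_le) (auto simp: degree_monom_le)
    fix y assume "y \<in> (\<lambda>i. \<zeta> ^ i) ` {..<N}"
    then obtain i where i: "i < N" "y = \<zeta> ^ i" by blast
    then have "poly P y = 0" unfolding P_def poly_prod by (intro prod_zero) auto
    moreover have "y ^ N = 1" using i root by (metis mult.commute power_mult power_one)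
    ultimately show "poly P y = poly (monom 1 N - 1) y" by (simp add: poly_monom)
  qed (simp add: deg)
  then have "poly P w = w ^ N - 1" by (simp add: poly_monom)
  then show ?thesis unfolding P_def by (simp add: poly_prod)
qed

lemma root_power_sum:
  assumes "0 < r" "r < N"
  shows "(\<Sum>k<N. (\<zeta> ^ r) ^ k) = 0"
proof -
  have "\<zeta> ^ r \<noteq> \<zeta> ^ 0" using inj_onD[OF primitive, of r 0] assms by auto
  moreover have "(\<zeta> ^ r) ^ N = 1" using root by (metis mult.commute power_mult power_one)
  ultimately show ?thesis using power_diff_1_eq[of "\<zeta> ^ r" N] by auto
qed

end

section \<open>The residue field at a prime ideal containing \<open>p\<close>\<close>

locale unity_root_ideal = comm_ring_ideal M + unity_root \<zeta> N
  for M :: "int poly set" and \<zeta> N +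
  fixes q p k :: nat
  assumes p_prime: "prime p" and q_def: "q = p ^ k" and q_ge: "q \<ge> 3" and N_def: "N = q\<^sup>2 - 1"
    and p_in_M: "of_nat p \<in> M" and kernel: "\<And>f. ev f = 0 \<Longrightarrow> f \<in> M"
    and one_notin_M: "1 \<notin> M" and prime_M: "\<And>f g. f * g \<in> M \<Longrightarrow> f \<in> M \<or> g \<in> M"
begin

lemma eqM_if_ev_eq: "ev f = ev g \<Longrightarrow> f \<approx> g"
  using kernel by (simp add: eqM_def)

lemma q_in_M: "of_nat q \<in> M"
proof -
  have "k \<noteq> 0" using q_def q_ge by (auto intro: Nat.gr0I)
  then obtain k' where "k = Suc k'" using not0_implies_Suc by blast
  then show ?thesis using mult_M[OF p_in_M, of "of_nat (p ^ k')"] q_def by (simp add: mult.commute)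
qed

text \<open>The power map with exponent \<open>q\<^sup>2\<close> is additive modulo \<open>M\<close>
  and fixes X and the integers, hence every residue. So each residue is a root of T (T^N - 1), which
  splits into T and the factors T - X^i, and primality of \<open>M\<close> selects one
  factor.\<close>

lemma residue_field: "residue_field M [:0, 1:] q N"
proof -
  let ?X = "[:0, 1 :: int:]"
  have frob: "(x + y) ^ q \<approx> x ^ q + y ^ q" for x y
    unfolding q_def by (rule freshmans_dream_prime_power[OF p_prime p_in_M])
  define Q where "Q = q\<^sup>2"
  have frobQ: "(x + y) ^ Q \<approx> x ^ Q + y ^ Q" for x y
    using freshmans_dream_prime_power[OF p_prime p_in_M, of x y "2 * k"]
    unfolding Q_def q_def by (simp add: mult.commute flip: power_mult)
  have QN: "Q = Suc N" unfolding Q_def N_def using q_ge by simp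
  have fix_add: "(x + y) ^ Q \<approx> x + y" if "x ^ Q \<approx> x" "y ^ Q \<approx> y" for x y
    using eqM_trans[OF frobQ eqM_add[OF that]] .
  have fix_nat: "of_nat m ^ Q \<approx> of_nat m" for m
  proof (induction m)
    case (Suc m)
    then show ?case using fix_add[of "1" "of_nat m"] by simp
  qed (simp add: QN)
  have fix_minus: "(- x) ^ Q \<approx> - x" if "x ^ Q \<approx> x" for x
  proof -
    have "0 = (x + - x) ^ Q" by (simp add: QN)
    also have "\<dots> \<approx> x ^ Q + (- x) ^ Q" by (rule frobQ)
    also have "\<dots> \<approx> x + (- x) ^ Q" by (intro eqM_add that) auto
    finally have "0 - x \<approx> x + (- x) ^ Q - x" by (intro eqM_diff) auto
    from eqM_sym[OF this] show ?thesis by simp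
  qed
  have fix_int: "of_int m ^ Q \<approx> of_int m" for m
    by (cases m rule: int_cases2) (use fix_nat fix_minus[OF fix_nat] in auto)
  have frob_fix: "x ^ Q \<approx> x" for x
  proof (induction x)
    case (pCons a x)
    have "(?X * x) ^ Q = ?X ^ Q * x ^ Q" by (rule power_mult_distrib)
    also have "\<dots> \<approx> ?X * x" 
      by (rule eqM_mult[OF eqM_if_ev_eq pCons.IH]) (simp only: ev_simps QN power_Suc root mult_1_right)
    finally have "(of_int a + ?X * x) ^ Q \<approx> of_int a + ?X * x" by (intro fix_add fix_int)
    moreover have "of_int a + ?X * x = pCons a x" by (simp add: of_int_poly)
    ultimately show ?case by simp
  qed (simp add: QN)
  have residue: "x \<in> M \<or> (\<exists>i. x \<approx> ?X ^ i)" for x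
  proof -
    have "x * (x ^ N - 1) \<in> M" using frob_fix[of x] by (simp add: QN eqM_def algebra_simps)
    moreover have "(\<Prod>i<N. x - ?X ^ i) \<approx> x ^ N - 1"
      by (intro eqM_if_ev_eq) (simp add: ev_prod prod_diff_root)
    ultimately have "x \<in> M \<or> (\<Prod>i<N. x - ?X ^ i) \<in> M"
      using prime_M eqM_trans eqM_0_iff by blast
    moreover have "\<exists>i\<in>I. x - ?X ^ i \<in> M" if "finite I" "(\<Prod>i\<in>I. x - ?X ^ i) \<in> M" for I
      using that by (induction I rule: finite_induct) (use one_notin_M prime_M in auto)
    ultimately show ?thesis unfolding eqM_def by blast
  qed
  have power: "?X ^ i \<approx> 1 \<longleftrightarrow> N dvd i" for i
  proof
    assume "N dvd i"
    then show "?X ^ i \<approx> 1" by (intro eqM_if_ev_eq) (auto simp: power_mult root elim: dvdE)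
  next
    assume *: "?X ^ i \<approx> 1"
    show "N dvd i"
    proof (rule ccontr)
      assume "\<not> N dvd i"
      moreover define r where "r = i mod N"
      ultimately have r: "0 < r" "r < N" using N_pos by (auto simp: dvd_eq_mod_eq_0)
      have "?X ^ r \<approx> ?X ^ i" unfolding r_def by (intro eqM_if_ev_eq) (simp flip: power_root_mod)
      then have r1: "?X ^ r \<approx> 1" using * eqM_trans by blast
      \<comment> \<open>With X^r congruent to 1, the vanishing geometric sum reduces to
        \<open>N\<close>. Then \<open>M\<close> would contain \<open>N\<close> and \<open>q\<close>,
        hence \<open>q * q - N = 1\<close>.\<close>
      have "0 \<approx> (\<Sum>k<N. (?X ^ r) ^ k)" by (intro eqM_if_ev_eq) (simp add: ev_sum root_power_sum[OF r])
      also have "\<dots> \<approx> (\<Sum>k<N. 1 ^ k)" by (intro eqM_sum eqM_power r1)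
      also have "\<dots> = of_nat N" by simp
      finally have "of_nat N \<in> M" unfolding eqM_0_iff[symmetric] by (rule eqM_sym)
      then have "of_nat q * of_nat q - of_nat N \<in> M"
        using add_M[OF mult_M[OF q_in_M] minus_M] by fastforce
      also have "of_nat q * of_nat q - of_nat N = (of_nat (q * q - N) :: int poly)"
        by (simp add: N_def power2_eq_square of_nat_diff)
      also have "q * q - N = 1" using QN by (simp add: Q_def power2_eq_square)
      finally show False using one_notin_M by simp
    qed
  qed
  show ?thesis
    by unfold_locales (fact q_ge N_def one_notin_M residue power frob)+
qed

end

text \<open>\<open>J\<close> is the preimage of the multiples of \<open>p\<close>. It is proper
  since \<open>p\<close> is not invertible in the ring generated by the root, and a prime ideal
  above it gives the field.\<close>

lemma (in unity_root) residue_field_ex: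
  fixes q p k :: nat
  assumes "prime p" "q = p ^ k" "q \<ge> 3" "N = q\<^sup>2 - 1"
  shows "\<exists>M. residue_field M [:0, 1 :: int:] q N"
proof -
  define J where "J = {f. \<exists>g. ev f = of_nat p * ev g}"
  have J: "comm_ring_ideal J"
  proof
    have "ev 0 = of_nat p * ev 0" by simp
    then show "0 \<in> J" unfolding J_def by blast
  next
    fix f g assume "f \<in> J" "g \<in> J"
    then obtain f' g' where "ev f = of_nat p * ev f'" "ev g = of_nat p * ev g'" by (auto simp: J_def)
    then have "ev (f + g) = of_nat p * ev (f' + g')" by (simp add: distrib_left)
    then show "f + g \<in> J" unfolding J_def by blast
  next
    fix f h assume "f \<in> J"
    then obtain f' where "ev f = of_nat p * ev f'" by (auto simp: J_def)
    then have "ev (h * f) = of_nat p * ev (h * f')" by simp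
    then show "h * f \<in> J" unfolding J_def by blast
  qed
  have "1 \<notin> J" unfolding J_def using prime_times_ev_neq_1[OF assms(1)] by auto
  with J obtain M where M: "comm_ring_ideal M" "J \<subseteq> M" "1 \<notin> M"
    "\<And>x y. x * y \<in> M \<Longrightarrow> x \<in> M \<or> y \<in> M"
    using comm_ring_ideal_prime_extension[of J] by metis
  have p: "of_nat p \<in> M"
  proof -
    have "ev (of_nat p) = of_nat p * ev 1" by simp
    then show ?thesis using M(2) unfolding J_def by blast
  qed
  have ker: "f \<in> M" if "ev f = 0" for f
  proof -
    have "ev f = of_nat p * ev 0" using that by simp
    then show ?thesis using M(2) unfolding J_def by blast
  qed
  have "unity_root_ideal M \<zeta> N q p k"
    by (intro unity_root_ideal.intro unity_root_ideal_axioms.intro)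
      (fact M assms p ker unity_root_axioms)+
  then show ?thesis using unity_root_ideal.residue_field by blast
qed

theorem theorem4p1:
  fixes q n :: nat
  assumes "primepow q" and "q \<ge> 3" and "n = q\<^sup>2 - 1"
  shows "\<exists>Q. quantum_code q n (nat ((int q)\<^sup>2 - 4 * int q + 5)) q Q"
proof -
  obtain p k where pk: "prime p" "q = p ^ k" using assms(1) by (auto simp: primepow_def)
  have "3 * 3 \<le> q * q" using assms(2) by (intro mult_mono) auto
  then have "n > 0" using assms(3) by (simp add: power2_eq_square)
  interpret unity_root "cis (2 * pi / n)" n
  proof
    show "n > 0" by fact
    then show "cis (2 * pi / n) ^ n = 1" by (simp add: DeMoivre)
    show "inj_on (\<lambda>i. cis (2 * pi / n) ^ i) {..<n}"
      using bij_betw_roots_unity[OF \<open>n > 0\<close>] by (simp add: DeMoivre bij_betw_def mult_ac)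
  qed
  obtain M where "residue_field M [:0, 1 :: int:] q n"
    using residue_field_ex[OF pk assms(2,3)] by blast
  then obtain Q where "quantum_code q n (n - 2 * (2 * q - 3)) q Q"
    using residue_field.quantum_code_ex by blast
  moreover have "n - 2 * (2 * q - 3) = nat ((int q)\<^sup>2 - 4 * int q + 5)"
  proof -
    \<comment> \<open>Writing \<open>q = m + 3\<close> shows that no subtraction of natural numbers
      truncates.\<close>
    obtain m where m: "q = m + 3" using assms(2) by (metis le_add_diff_inverse2)
    have "int (n - 2 * (2 * q - 3)) = (int q)\<^sup>2 - 4 * int q + 5"
      unfolding assms(3) m by (simp add: power2_eq_square algebra_simps of_nat_diff)
    then show ?thesis by simp
  qed
  ultimately show ?thesis by auto
qed

end
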